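(* Let $G^c$ be a connected $c$-edge-coloured multigraph on $n \geq 9$ vertices with $3 \leq c < \frac{n}{2}$ and $m$ edges. If $m\geq c\binom{n-2}{2}+n$, then $G^c$ has a proper Hamiltonian path.
   Context: A $c$-edge-coloured multigraph $G^c$ is a multigraph in which every edge receives one colour from $\{1,\ldots,c\}$ and no two parallel edges joining the same pair of vertices have the same colour; $m$ counts all edges. A path is proper if any two consecutive edges have different colours; a proper Hamiltonian path is a proper path containing all vertices. *)

theory Defs
  imports Complex_Main
begin

text \<open>Undirected finite multigraphs: edges are abstract objects, each with a set of two
  endpoints (so there are no loops); distinct edges may have the same endpoints.\<close>

locale multigraph =
  fixes V :: "'v set" and E :: "'e set" and ends :: "'e \<Rightarrow> 'v set"
  assumes finite_V: "finite V"
    and finite_E: "finite E"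
    and ends_subset: "e \<in> E \<Longrightarrow> ends e \<subseteq> V"
    and card_ends: "e \<in> E \<Longrightarrow> card (ends e) = 2"
begin

text \<open>Because of parallel edges a path is given by its vertices \<open>vs\<close> together with
  its edges \<open>es\<close>.\<close>

definition is_path :: "'v list \<Rightarrow> 'e list \<Rightarrow> bool" where
  "is_path vs es \<longleftrightarrow>
     length vs = Suc (length es) \<and> set vs \<subseteq> V \<and> distinct vs \<and>
     (\<forall>i < length es. es ! i \<in> E \<and> ends (es ! i) = {vs ! i, vs ! Suc i})"

definition connected_graph :: bool where
  "connected_graph \<longleftrightarrow>
     V \<noteq> {} \<and> (\<forall>u\<in>V. \<forall>v\<in>V. \<exists>vs es. is_path vs es \<and> hd vs = u \<and> last vs = v)"

end

text \<open>The colouring need not use all of the colours \<open>1, \<dots>, c\<close>.\<close>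

locale edge_coloured_multigraph = multigraph V E ends
  for V :: "'v set" and E :: "'e set" and ends :: "'e \<Rightarrow> 'v set" +
  fixes col :: "'e \<Rightarrow> nat" and c :: nat
  assumes col_range: "e \<in> E \<Longrightarrow> col e \<in> {1..c}"
    and parallel_col:
      "\<lbrakk>e \<in> E; f \<in> E; e \<noteq> f; ends e = ends f\<rbrakk> \<Longrightarrow> col e \<noteq> col f"
begin

definition is_proper_path :: "'v list \<Rightarrow> 'e list \<Rightarrow> bool" where
  "is_proper_path vs es \<longleftrightarrow>
     is_path vs es \<and>
     (\<forall>i. Suc i < length es \<longrightarrow> col (es ! i) \<noteq> col (es ! Suc i))"

definition is_proper_hamiltonian_path :: "'v list \<Rightarrow> 'e list \<Rightarrow> bool" where
  "is_proper_hamiltonian_path vs es \<longleftrightarrow> is_proper_path vs es \<and> set vs = V"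

end

end

theory Submission
  imports Defs "HOL-Library.Multiset"
begin

text \<open>Call a pair of vertices strong if it carries at least two colours. A path of strong pairs can be
  coloured greedily from any prescribed colour at one end, so a Hamiltonian path is properly
  colourable if it has at most one pair that is not strong, or two such pairs with a pair carrying
  three colours between them. Suppose that there is no Hamiltonian path of these kinds, and cover the
  vertices by as few strong paths as possible. If \<open>x\<close> and \<open>y\<close> are ends of different paths, no pair of
  crossing edges may merge paths of the cover, so that \<open>x\<close> and \<open>y\<close> together miss many colours, and by
  rotation the same holds for many other ends. Covers by two or by at least four paths thereby miss
  more than \<open>c (2 n - 3) - n\<close> coloured edges, except when an end has no strong neighbour at all, where
  the Hamiltonian paths of the remaining graph have to be examined. A cover by three paths leaves
  hardly any room for empty pairs, so two of the joins between the paths can be made.\<close>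

section \<open>Covers by paths and rotations\<close>

text \<open>The constant \<open>c * (2 * n - 3) - n\<close> is what the edge bound allows to be
  missing: all pairs in all colours give \<open>c * (n choose 2)\<close> edges, and
  \<open>n choose 2\<close> exceeds \<open>(n - 2) choose 2\<close> by \<open>2 * n - 3\<close>.
  Sums run over ordered pairs, so this allowance appears doubled. Counting alone cannot exclude
  covers by three paths. Two vertices whose pairs all carry one colour lose
  \<open>(c - 1) * (4 * n - 6)\<close>, which is \<open>2 * n - 6\<close> below the doubled
  allowance. For \<open>c = 3\<close> and \<open>n = 9\<close>, six vertices with one colour on each
  pair among them, joined in all colours to the other three, need three paths but lose only 60 of
  72. Such graphs are the reason for admitting two joins that are not strong. They fix the colours
  at both ends of the middle path, and greedy colouring from one end may fail at the other unless
  some pair leaves a third choice. Without such a pair, all pairs of the path carry exactly two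
  colours and lose \<open>c - 2\<close> each; with one, one of the joins must be empty and loses all
  \<open>c\<close>. The three-path case weighs these two costs against the little that is
  left.\<close>

locale sgraph =
  fixes V :: "'v set" and S :: "'v \<Rightarrow> 'v \<Rightarrow> bool"
  assumes fin [simp]: "finite V"
    and S_sym: "S u v \<Longrightarrow> S v u"
    and S_irrefl [simp]: "\<not> S u u"
begin

definition deg :: "'v \<Rightarrow> nat" where
  "deg x = card {u \<in> V. S x u}"

fun adj :: "'v option \<Rightarrow> 'v option \<Rightarrow> bool" where
  "adj (Some u) (Some v) = S u v"
| "adj None q = True"
| "adj p None = True"

text \<open>A cover of \<open>V\<close> by \<open>m + 1\<close> disjoint paths is a single list in which \<open>None\<close>
  separates consecutive paths; \<open>None\<close> behaves like a vertex adjacent to everything.\<close>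

definition cov :: "nat \<Rightarrow> 'v option list \<Rightarrow> bool" where
  "cov m vs \<longleftrightarrow> successively adj vs \<and>
     mset vs = image_mset Some (mset_set V) + replicate_mset m None"

text \<open>For \<open>m = 0\<close> these are the ends of one spanning path. For
  \<open>m > 0\<close> a separator lies between them, so they are ends of different paths; permuting
  and reversing the paths brings any two such ends to the outside.\<close>

definition endp :: "nat \<Rightarrow> 'v \<Rightarrow> 'v \<Rightarrow> bool" where
  "endp m x y \<longleftrightarrow> (\<exists>vs. cov m vs \<and> vs \<noteq> [] \<and> hd vs = Some x \<and> last vs = Some y)"

lemma adj_sym: "adj p q \<longleftrightarrow> adj q p"
  by (cases p; cases q) (auto intro: S_sym)

lemma adj_None [simp]: "adj p None"
  by (cases p) auto

lemma successively_adj_rev [simp]: "successively adj (rev vs) \<longleftrightarrow> successively adj vs"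
  unfolding successively_rev using adj_sym by (metis (no_types, lifting) successively_mono)

lemma cov_rev [simp]: "cov m (rev vs) \<longleftrightarrow> cov m vs"
  by (simp add: cov_def del: successively_rev)

lemma endp_sym: "endp m x y \<Longrightarrow> endp m y x"
  unfolding endp_def
  by (metis cov_rev hd_rev last_rev rev_is_Nil_conv)

lemma cov_rot:
  assumes "cov m (us @ ws)" "us \<noteq> []" "ws \<noteq> []" "adj (hd us) (hd ws)"
  shows "cov m (rev us @ ws)"
  using assms successively_adj_rev[of us] by (simp add: cov_def successively_append_iff last_rev)

lemma cov_append_swap:
  assumes "cov m (us @ ws)" "us \<noteq> [] \<Longrightarrow> adj (last ws) (hd us)"
  shows "cov m (ws @ us)"
  using assms by (auto simp: cov_def successively_append_iff add.commute)

text \<open>A leading separator bounds an empty path. This is how a cover is shown not to be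
  minimal.\<close>

lemma cov_drop_None_hd: "cov (Suc m) (None # vs) \<Longrightarrow> cov m vs"
  by (auto simp: cov_def successively_Cons)

lemma None_in_cov: "cov (Suc m) vs \<Longrightarrow> None \<in> set vs"
  unfolding cov_def by (metis add_mset_add_single count_eq_zero_iff count_replicate_mset count_union nat.simps(3)
      add_is_0 set_mset_mset)

lemma None_notin_cov0: "cov 0 vs \<Longrightarrow> None \<notin> set vs"
  unfolding cov_def by (simp flip: set_mset_mset)

text \<open>The list closes up to a cycle, which can be reopened at any separator; that separator
  then stands in front and is dropped.\<close>

lemma cov_cycle:
  assumes "cov (Suc m) vs" "adj (last vs) (hd vs)"
  shows "\<exists>vs'. cov m vs'"
proof -
  obtain as bs where vs: "vs = as @ None # bs"
    using None_in_cov[OF assms(1)] by (meson split_list)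
  have "cov (Suc m) ((None # bs) @ as)"
  proof (rule cov_append_swap)
    show "cov (Suc m) (as @ None # bs)" using assms(1) vs by simp
    show "adj (last (None # bs)) (hd as)" if "as \<noteq> []"
      using assms(2) vs that by (cases bs) auto
  qed
  then show ?thesis using cov_drop_None_hd by fastforce
qed

lemma set_cov: "cov m vs \<Longrightarrow> Some u \<in> set vs \<longleftrightarrow> u \<in> V"
  unfolding cov_def by (auto simp flip: set_mset_mset simp: image_iff)

lemma length_cov: "cov m vs \<Longrightarrow> length vs = card V + m"
  unfolding cov_def by (metis size_image_mset size_mset size_mset_set size_replicate_mset size_union)

lemma cov_nth_inj:
  assumes "cov m vs" "i < length vs" "j < length vs" "vs ! i = Some u" "vs ! j = Some u"
  shows "i = j"
proof -
  have "count (mset vs) (Some u) \<le> 1"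
    using assms(1) unfolding cov_def
    using count_image_mset'[of Some "mset_set V" "Some u"] card_mono[of "{u}" "{x. u = x \<and> x \<in> V}"]
    by (auto simp: count_mset_set')
  then have "card {i. i < length vs \<and> Some u = vs ! i} \<le> 1"
    by (simp only: count_mset count_list_eq_length_filter length_filter_conv_card)
  moreover
  have "{i,j} \<subseteq> {i. i < length vs \<and> Some u = vs ! i}" using assms by auto
  then have "card {i,j} \<le> card {i. i < length vs \<and> Some u = vs ! i}"
    by (intro card_mono) auto
  ultimately have "card {i,j} \<le> 1" by linarith
  then show ?thesis by (cases "i = j") auto
qed

text \<open>The \<open>m\<close> separators count as neighbours of \<open>x\<close>, which is why
  rotation yields \<open>deg x + m\<close> ends.\<close>

lemma card_adj_positions:
  assumes "cov m vs"
  shows "card {i. i < length vs \<and> adj (Some x) (vs ! i)} = deg x + m"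
proof -
  have "card {i. i < length vs \<and> adj (Some x) (vs ! i)} = size (filter_mset (adj (Some x)) (mset vs))"
    by (metis length_filter_conv_card mset_filter size_mset)
  also have "filter_mset (adj (Some x)) (replicate_mset m None) = replicate_mset m None"
    by (induction m) auto
  then have "size (filter_mset (adj (Some x)) (mset vs)) =
      size (filter_mset (adj (Some x)) (image_mset Some (mset_set V))) + m"
    using assms by (simp add: cov_def)
  also have "filter_mset (adj (Some x)) (image_mset Some (mset_set V))
      = image_mset Some (mset_set {u \<in> V. S x u})"
    by (simp add: filter_mset_image_mset)
  finally show ?thesis by (simp add: deg_def)
qed

lemma endp_nonadj:
  assumes "\<nexists>vs. cov m vs" "endp (Suc m) x y"
  shows "\<not> S x y"
proof
  assume "S x y"
  obtain vs where "cov (Suc m) vs" "hd vs = Some x" "last vs = Some y"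
    using assms unfolding endp_def by auto
  then show False using cov_cycle[of m vs] \<open>S x y\<close> S_sym assms(1) by auto
qed

text \<open>Reversing an initial segment of a cover turns the vertex before each neighbour of the
  first vertex into an end, while the last vertex stays in place.\<close>

lemma rotation:
  assumes min: "\<forall>m' vs. m = Suc m' \<longrightarrow> \<not> cov m' vs"
    and e: "endp m x y" and two: "2 \<le> card V"
  shows "\<exists>X\<subseteq>V. x \<in> X \<and> y \<notin> X \<and> card X = deg x + m \<and> (\<forall>u\<in>X. endp m u y)"
proof -
  obtain vs where vs: "cov m vs" "vs \<noteq> []" "hd vs = Some x" "last vs = Some y"
    using e unfolding endp_def by auto
  define N where "N = length vs"
  have N2: "N \<ge> 2" using length_cov[OF vs(1)] two N_def by simp
  have v0: "vs ! 0 = Some x" using vs by (simp add: hd_conv_nth)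
  have vl: "vs ! (N - 1) = Some y" using vs by (simp add: last_conv_nth N_def)
  define I where "I = {i. i < length vs \<and> adj (Some x) (vs ! i)}"
  have I0: "0 \<notin> I" using v0 by (simp add: I_def)
  have key: "\<exists>u. vs ! (i - 1) = Some u \<and> endp m u y" if i: "i \<in> I" for i
  proof -
    have i': "0 < i" "i < length vs" "adj (Some x) (vs ! i)" using i I0 by (auto simp: I_def intro: gr0I)
    have r: "cov m (rev (take i vs) @ drop i vs)"
    proof (rule cov_rot)
      show "adj (hd (take i vs)) (hd (drop i vs))" using i' vs by (simp add: hd_drop_conv_nth)
    qed (use i' vs in auto)
    have h: "hd (rev (take i vs) @ drop i vs) = vs ! (i - 1)"
      using i' vs(2) by (simp add: hd_append hd_rev last_conv_nth)
    have l: "last (rev (take i vs) @ drop i vs) = Some y" using i' vs by simp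
    show ?thesis
    proof (cases "vs ! (i - 1)")
      case None
      \<comment> \<open>A separator just before a neighbour of \<open>x\<close> would come to the
        front by the rotation, and the cover could be shortened.\<close>
      then have "None \<in> set vs" using i' by (metis less_imp_diff_less nth_mem)
      then obtain m' where m': "m = Suc m'" using None_notin_cov0 vs(1) by (cases m) auto
      obtain rest where "rev (take i vs) @ drop i vs = None # rest"
        using h None i' by (metis append_is_Nil_conv drop_eq_Nil leD list.collapse)
      then show ?thesis using min r m' cov_drop_None_hd by metis
    next
      case (Some u)
      then show ?thesis using r h l i' unfolding endp_def
        by (metis Nil_is_append_conv drop_eq_Nil leD)
    qed
  qed
  define X where "X = (\<lambda>i. the (vs ! (i - 1))) ` I"
  have inj: "inj_on (\<lambda>i. the (vs ! (i - 1))) I"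
  proof (rule inj_onI)
    fix i j assume ij: "i \<in> I" "j \<in> I" "the (vs ! (i - 1)) = the (vs ! (j - 1))"
    obtain u where "vs ! (i - 1) = Some u" "vs ! (j - 1) = Some u"
      using key[OF ij(1)] key[OF ij(2)] ij(3) by auto
    moreover have "i - 1 < length vs" "j - 1 < length vs" using ij by (auto simp: I_def)
    ultimately have "i - 1 = j - 1" using cov_nth_inj[OF vs(1)] by blast
    moreover have "i \<noteq> 0" "j \<noteq> 0" using I0 ij by metis+
    ultimately show "i = j" by linarith
  qed
  show ?thesis
  proof (intro exI[of _ X] conjI ballI)
    show "X \<subseteq> V"
    proof
      fix u assume "u \<in> X"
      then obtain i where i: "i \<in> I" "u = the (vs ! (i - 1))" unfolding X_def by blast
      have "vs ! (i - 1) \<in> set vs" using i by (auto simp: I_def)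
      then show "u \<in> V" using key[OF i(1)] i(2) set_cov[OF vs(1)] by (metis option.sel)
    qed
    \<comment> \<open>Position 1 always lies in \<open>I\<close>, and its predecessor is
      \<open>x\<close> itself.\<close>
    have "adj (vs ! 0) (vs ! Suc 0)"
      using vs(1) N2 by (auto simp: cov_def successively_conv_nth N_def)
    then have "1 \<in> I" using N2 v0 by (simp add: I_def N_def)
    then show "x \<in> X" unfolding X_def using v0 by (force simp: image_iff)
    show "y \<notin> X"
    proof
      assume "y \<in> X"
      then obtain i where i: "i \<in> I" "y = the (vs ! (i - 1))" unfolding X_def by blast
      have "vs ! (i - 1) = Some y" using key[OF i(1)] i(2) by auto
      moreover have "i \<noteq> 0" using i I0 by metis
      moreover have "i < N" using i by (auto simp: I_def N_def)
      ultimately have "i - 1 = N - 1" using cov_nth_inj[OF vs(1)] vl N_def N2 by simp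
      then show False using \<open>i < N\<close> \<open>i \<noteq> 0\<close> by linarith
    qed
    show "card X = deg x + m" unfolding X_def using card_image[OF inj] card_adj_positions[OF vs(1)] I_def by simp
    show "endp m u y" if uX: "u \<in> X" for u
    proof -
      obtain i where "i \<in> I" "u = the (vs ! (i - 1))" using uX unfolding X_def by blast
      then show ?thesis using key[of i] by auto
    qed
  qed
qed

text \<open>All \<open>deg x + m + 1\<close> ends obtained by rotation at \<open>x\<close> stay
  opposite to \<open>y\<close>, so none of them is adjacent to \<open>y\<close>. Together with the
  neighbours of \<open>y\<close> they fit into \<open>V - {y}\<close>.\<close>

lemma endp_deg_sum:
  assumes min: "\<nexists>vs. cov m vs" and e: "endp (Suc m) x y" and two: "2 \<le> card V"
  shows "deg x + deg y + m + 2 \<le> card V"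
proof -
  obtain X where X: "X \<subseteq> V" "x \<in> X" "y \<notin> X" "card X = deg x + Suc m"
     "\<And>u. u \<in> X \<Longrightarrow> endp (Suc m) u y"
    using rotation[OF _ e two] min by auto
  have yV: "y \<in> V" using e unfolding endp_def by (metis last_in_set set_cov)
  have "X \<inter> {u \<in> V. S y u} = {}" using endp_nonadj[OF min X(5)] S_sym by blast
  moreover have "X \<union> {u \<in> V. S y u} \<subseteq> V - {y}" using X by auto
  moreover have "finite X" using X(1) finite_subset fin by blast
  ultimately have "card X + deg y \<le> card (V - {y})"
    unfolding deg_def using card_mono[of "V - {y}" "X \<union> {u \<in> V. S y u}"] by (simp add: card_Un_disjoint)
  moreover have "card (V - {y}) = card V - 1" using yV by simp
  ultimately show ?thesis using X(4) two by linarith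
qed

lemma cov_exists: "\<exists>m vs. cov m vs"
proof -
  obtain xs where xs: "set xs = V" "distinct xs" using finite_distinct_list fin by blast
  have "successively adj (concat (map (\<lambda>v. [None, Some v]) ys))" for ys
  proof (induction ys)
    case (Cons a ys)
    then show ?case by (cases ys) (auto simp: successively_Cons)
  qed auto
  moreover have "mset (concat (map (\<lambda>v. [None, Some v]) ys)) =
     image_mset Some (mset ys) + replicate_mset (length ys) None" for ys
    by (induction ys) auto
  ultimately show ?thesis unfolding cov_def using xs mset_set_set by metis
qed

lemma cov_ends:
  assumes min: "\<nexists>vs. cov m vs" and "cov (Suc m) vs" "V \<noteq> {}"
  obtains x y where "endp (Suc m) x y"
proof -
  have ne: "vs \<noteq> []" using assms set_cov by fastforce
  have "hd vs \<noteq> None" using cov_drop_None_hd[of m "tl vs"] ne assms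
    by (metis list.collapse)
  moreover have "hd (rev vs) \<noteq> None" using cov_drop_None_hd[of m "tl (rev vs)"] ne assms
    by (metis list.collapse cov_rev rev_is_Nil_conv)
  ultimately show thesis using that ne assms(2) unfolding endp_def
    by (metis hd_rev not_None_eq)
qed

section \<open>Covers as tuples of vertex lists\<close>

lemma mset_Some_distinct:
  assumes "mset (map Some xs) = image_mset Some (mset_set V)"
  shows "distinct xs \<and> set xs = V"
proof -
  have "mset xs = mset_set V"
    using assms multiset.inj_map[OF inj_Some] by (metis injD mset_map)
  moreover obtain ys where "set ys = V" "distinct ys" using finite_distinct_list fin by blast
  ultimately show ?thesis by (metis mset_eq_imp_distinct_iff mset_eq_setD mset_set_set)
qed

lemma successively_adj_map [simp]: "successively adj (map Some xs) \<longleftrightarrow> successively S xs"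
  by (simp add: successively_map)

lemma no_None_map: "None \<notin> set ps \<Longrightarrow> \<exists>xs. ps = map Some xs"
  by (metis ex_map_conv not_None_eq)

lemma endp0_iff: "endp 0 x y \<longleftrightarrow>
  (\<exists>xs. xs \<noteq> [] \<and> distinct xs \<and> set xs = V \<and> successively S xs \<and> hd xs = x \<and> last xs = y)"
proof
  assume "endp 0 x y"
  then obtain vs where vs: "cov 0 vs" "vs \<noteq> []" "hd vs = Some x" "last vs = Some y" by (auto simp: endp_def)
  obtain xs where xs: "vs = map Some xs" using None_notin_cov0[OF vs(1)] no_None_map by blast
  then have "distinct xs \<and> set xs = V" "successively S xs"
    using vs mset_Some_distinct[of xs] by (auto simp: cov_def)
  then show "\<exists>xs. xs \<noteq> [] \<and> distinct xs \<and> set xs = V \<and> successively S xs \<and> hd xs = x \<and> last xs = y"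
    using vs xs by (auto simp: hd_map last_map intro!: exI[of _ xs])
next
  assume "\<exists>xs. xs \<noteq> [] \<and> distinct xs \<and> set xs = V \<and> successively S xs \<and> hd xs = x \<and> last xs = y"
  then obtain xs where xs: "xs \<noteq> []" "distinct xs" "set xs = V" "successively S xs" "hd xs = x" "last xs = y" by blast
  have "mset xs = mset_set V" using mset_set_set[OF xs(2)] xs(3) by simp
  then have "cov 0 (map Some xs)" using xs by (simp add: cov_def)
  then show "endp 0 x y" using xs by (auto simp: endp_def hd_map last_map intro!: exI[of _ "map Some xs"])
qed

lemma cov0_split:
  assumes "cov 0 vs"
  obtains xs where "distinct xs" "set xs = V" "successively S xs"
proof -
  obtain xs where xs: "vs = map Some xs" using None_notin_cov0[OF assms] no_None_map by blast
  then show thesis using that[of xs] assms mset_Some_distinct[of xs] by (auto simp: cov_def)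
qed

lemma cov_Suc_split:
  assumes "cov (Suc m) vs"
  obtains A rest where "vs = map Some A @ None # rest"
    "mset (map Some A @ rest) = image_mset Some (mset_set V) + replicate_mset m None"
    "successively S A" "successively adj rest"
proof -
  obtain ps rest where ps: "vs = ps @ None # rest" "None \<notin> set ps"
    using None_in_cov[OF assms] by (meson split_list_first)
  obtain A where "ps = map Some A" using ps no_None_map by blast
  then show thesis using that[of A rest] assms ps
    by (auto simp: cov_def successively_append_iff successively_Cons)
qed

lemma cov1_split:
  assumes "cov 1 vs"
  obtains A B where "vs = map Some A @ None # map Some B"
    "distinct (A @ B)" "set (A @ B) = V" "successively S A" "successively S B"
proof -
  obtain A rest where 1: "vs = map Some A @ None # rest"
    "mset (map Some A @ rest) = image_mset Some (mset_set V)" "successively S A" "successively adj rest"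
    using cov_Suc_split[of 0 vs] assms by auto
  have "None \<notin># mset (map Some A @ rest)" unfolding 1(2) by auto
  then obtain B where "rest = map Some B" using no_None_map by auto
  then show thesis using that[of A B] 1 mset_Some_distinct[of "A @ B"] by auto
qed

lemma cov2_split:
  assumes "cov 2 vs"
  obtains A B C where "vs = map Some A @ None # map Some B @ None # map Some C"
    "distinct (A @ B @ C)" "set (A @ B @ C) = V" "successively S A" "successively S B" "successively S C"
proof -
  obtain A rest where 1: "vs = map Some A @ None # rest"
    "mset (map Some A @ rest) = image_mset Some (mset_set V) + replicate_mset 1 None"
    "successively S A" "successively adj rest"
    using cov_Suc_split[of 1 vs] assms by (auto simp: numeral_2_eq_2)
  have "None \<in># mset (map Some A @ rest)" unfolding 1(2) by auto
  then have "None \<in> set rest" by auto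
  then obtain ps rest' where ps: "rest = ps @ None # rest'" by (meson split_list)
  then have "mset (map Some A @ ps @ rest') = image_mset Some (mset_set V)"
    using 1(2) by simp
  then have m: "mset (map Some A @ ps @ rest') = image_mset Some (mset_set V)" .
  have "None \<notin># mset (map Some A @ ps @ rest')" unfolding m by auto
  then have "\<exists>B. ps = map Some B" "\<exists>C. rest' = map Some C" by (auto intro!: no_None_map)
  then obtain B C where "ps = map Some B" "rest' = map Some C" by blast
  then show thesis using that[of A B C] 1 ps m mset_Some_distinct[of "A @ B @ C"]
    by (auto simp: successively_append_iff successively_Cons)
qed

end

section \<open>Numerical estimates\<close>

text \<open>\<open>p\<close> and \<open>q\<close> are the degrees of two opposite ends. The right
  side is twice the loss forced at \<open>p + 1\<close> rotated ends and the opposite end;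
  \<open>c * ((p + 2) * (p + 1))\<close> pays for the pairs among these vertices, which are counted
  twice. For \<open>p = 1\<close> and \<open>p + q = n - 2\<close> the two sides differ by
  \<open>2 * (n - 2 * c)\<close>, so \<open>c < n / 2\<close> is exactly what is needed
  there.\<close>

lemma arith_k2:
  fixes c n p q :: int
  assumes c: "3 \<le> c" and n: "9 \<le> n" "2 * c + 1 \<le> n" and p: "1 \<le> p" "p \<le> q" "p + q \<le> n - 2"
  shows "2 * (c * (2 * n - 3) - n) + c * ((p + 2) * (p + 1))
     < 2 * ((p + 1) * ((c - 1) * (n - 1 - p) + q + 1) + (c - 1) * (n - 1 - q) + p + 1)"
proof -
  define r where "r = q - p"
  define t where "t = n - 2 - p - q"
  have rt: "0 \<le> r" "0 \<le> t" using p by (auto simp: r_def t_def)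
  have q: "q = p + r" and nn: "n = 2 * p + r + t + 2" by (auto simp: r_def t_def)
  have pos: "0 \<le> r * (c - 3)" "0 \<le> t * (c - 3)" using rt c by auto
  have pos2: "0 \<le> r * (c - 3) * (p - 1)" "0 \<le> t * (c - 3) * (p - 1)" using pos p by auto
  have "0 < c * (p * p) - 5 * (c * p) + 4 * p + 4 + 2 * (r * (c * (p - 1) + 1)) + 2 * (t * ((c - 1) * p - 1))"
  proof -
    consider "p = 1" | "p = 2" | "p = 3" | "p = 4" | "p \<ge> 5" using p by linarith
    then show ?thesis
    proof cases
      case 1 then show ?thesis using pos n nn by (simp add: algebra_simps)
    next
      case 2 then show ?thesis using pos rt n nn c
        mult_right_mono[of 3 "r + t" "2 * c"] by (simp add: algebra_simps)
    next
      case 3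
      show ?thesis
      proof (cases "c \<le> 8")
        case True
        then show ?thesis using 3 pos rt n nn c mult_right_mono[of 1 "r + t" "4*c"]
          by (simp add: algebra_simps)
      next
        case False
        then show ?thesis using 3 pos rt n nn c mult_right_mono[of 3 "r + t" "4*c"] by (simp add: algebra_simps)
      qed
    next
      case 4
      show ?thesis
      proof (cases "c \<le> 4")
        case True
        then show ?thesis using 4 pos rt n nn c by (simp add: algebra_simps)
      next
        case False
        then show ?thesis using 4 pos rt n nn c mult_right_mono[of 1 "r + t" "4*c"] by (simp add: algebra_simps)
      qed
    next
      case 5
      have "0 \<le> c * (p * (p - 5))" using 5 c by auto
      moreover have "0 \<le> r * (c * (p - 1) + 1)" using rt c p by auto
      moreover have "0 \<le> t * ((c - 1) * p - 1)"
        using rt c p mult_mono[of 1 "c - 1" 1 p] by auto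
      ultimately show ?thesis using p by (simp add: algebra_simps)
    qed
  qed
  moreover have "2 * ((p + 1) * ((c - 1) * (n - 1 - p) + q + 1) + (c - 1) * (n - 1 - q) + p + 1)
     - (2 * (c * (2 * n - 3) - n) + c * ((p + 2) * (p + 1)))
    = c * (p * p) - 5 * (c * p) + 4 * p + 4 + 2 * (r * (c * (p - 1) + 1)) + 2 * (t * ((c - 1) * p - 1))"
    unfolding nn q by (simp add: algebra_simps)
  ultimately show ?thesis by linarith
qed

lemma arith_k4:
  fixes c n h Q :: int
  assumes c: "3 \<le> c" and n: "9 \<le> n" and h: "0 \<le> h" "2 * h \<le> n - 4"
    and Q: "(h + 3) * (2 * n - 4 - 3 * h) \<le> Q" and bd: "(c - 1) * Q \<le> 2 * (c * (2 * n - 3) - n)"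
  shows False
proof -
  define s where "s = n - 4 - 2 * h"
  have s: "0 \<le> s" "n = 2 * h + 4 + s" using h by (auto simp: s_def)
  \<comment> \<open>\<open>(c - 1) * (5 * n - 8)\<close> exceeds the allowance by
    \<open>(c - 3) * (n - 2) + 2\<close>, hence by just 2 for \<open>c = 3\<close>. The claim itself
    is an equality at \<open>h = 3\<close>, \<open>s = 0\<close>.\<close>
  have "5 * n - 8 \<le> (h + 3) * (2 * n - 4 - 3 * h)"
  proof -
    have "0 \<le> h * (h - 3 + 2 * s) + s"
    proof -
      consider "h = 0" | "h = 1" | "h = 2" | "h \<ge> 3" using h by linarith
      then show ?thesis
      proof cases
        case 4
        then have "0 \<le> h * (h - 3 + 2 * s)" using s by auto
        then show ?thesis using s by linarith
      qed (use s n in auto)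
    qed
    then show ?thesis unfolding s(2) by (simp add: algebra_simps)
  qed
  then have "(c - 1) * (5 * n - 8) \<le> (c - 1) * Q" using Q c by (intro mult_left_mono) auto
  moreover have "0 \<le> (c - 3) * (n - 2)" using c n by auto
  ultimately show False using bd n by (simp add: algebra_simps)
qed

text \<open>In this and the next two estimates, \<open>d\<close> is the number of vertices joined to
  a vertex \<open>x\<close> without strong neighbours, and \<open>D\<close> is the loss, away from
  \<open>x\<close>, of an end of degree \<open>q\<close> of a path on the other vertices. For
  \<open>q = 1\<close> and \<open>q = 2\<close> the rows of \<open>q + 1\<close> rotated ends are
  doubled, with a correction for the pairs inside; from \<open>q = 3\<close> on the plain rows are
  used.\<close>

lemma arith_iso_small1:
  fixes c n d D :: int
  assumes c: "3 \<le> c" and n: "9 \<le> n" and d: "d \<le> n - 3"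
    and D: "(c - 1) * (n - 3) \<le> D"
    and bd: "2 * (2 * D) \<le> 2 * (c * (n - 2) - n + d) + c * (2 * 1)"
  shows False
proof -
  have "0 \<le> (c - 3) * (n - 5)" using c n by auto
  then show False using D bd d n by (simp add: algebra_simps)
qed

lemma arith_iso_small2:
  fixes c n d D :: int
  assumes c: "3 \<le> c" and n: "9 \<le> n" and d: "d \<le> n - 4"
    and D: "(c - 1) * (n - 4) \<le> D"
    and bd: "2 * (3 * D) \<le> 2 * (c * (n - 2) - n + d) + c * (3 * 2)"
  shows False
proof -
  have "0 \<le> (c - 3) * (n - 9)" using c n by auto
  then show False using D bd d n c by (simp add: algebra_simps)
qed

lemma arith_iso:
  fixes c n d D q e z :: int
  assumes c: "3 \<le> c" and n: "9 \<le> n" "2 * c + 1 \<le> n" and d: "1 \<le> d" "d \<le> e" and e: "2 \<le> e" and q: "3 \<le> q" "e = n - 2 - q"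
    and z: "d \<le> z \<or> c - 2 \<le> z"
    and D: "(c - 1) * e + z \<le> D"
    and bd: "(q + 1) * D \<le> 2 * (c * (n - 2) - n + d)"
  shows False
proof -
  have nn: "n = q + e + 2" using q by simp
  have "(q + 1) * ((c - 1) * e + z) \<le> (q + 1) * D" using D q by (intro mult_left_mono) auto
  then have bd': "(q + 1) * ((c - 1) * e + z) \<le> 2 * (c * (q + e) - (q + e + 2) + d)"
    using bd nn by simp
  show False
  proof (cases "e = 2")
    case True
    have q5: "q \<ge> 5" "q \<ge> 2 * c - 3" using n nn True by auto
    have b: "(q + 1) * (2 * (c - 1) + z) \<le> 2 * (c * (q + 2) - (q + 4) + d)" using bd' True by (simp add: algebra_simps)
    show False using z
    proof
      assume "d \<le> z"
      then have "(q + 1) * d \<le> (q + 1) * z" using q by (intro mult_left_mono) auto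
      moreover have "0 \<le> (q - 1) * (d - 1)" using q d by auto
      ultimately show False using b q5 by (simp add: algebra_simps)
    next
      assume "c - 2 \<le> z"
      then have "(q + 1) * (c - 2) \<le> (q + 1) * z" using q by (intro mult_left_mono) auto
      moreover have "0 \<le> (q - 5) * (c - 2)" using q5 c by auto
      ultimately show False using b q5 d True c by (simp add: algebra_simps)
    qed
  next
    case False
    then have e3: "3 \<le> e" using e by simp
    have "2 * 1 \<le> (q - 1) * (e - 2)" using q e3 by (intro mult_mono) auto
    then have A: "0 \<le> (c - 3) * ((q - 1) * (e - 2) - 2)" using c by auto
    show False using z
    proof
      assume "d \<le> z"
      then have "(q + 1) * d \<le> (q + 1) * z" using q by (intro mult_left_mono) auto
      moreover have "0 \<le> (q - 1) * (d - 1)" using q d by auto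
      ultimately show False using bd' A \<open>2 * 1 \<le> (q - 1) * (e - 2)\<close> q by (simp add: algebra_simps)
    next
      assume "c - 2 \<le> z"
      then have "(q + 1) * (c - 2) \<le> (q + 1) * z" using q by (intro mult_left_mono) auto
      moreover have "0 \<le> (q - 3) * (e - 3)" "0 \<le> (q - 3) * (c - 3)" using q e3 c by auto
      ultimately show False using bd' A d e3 c q by (simp add: algebra_simps)
    qed
  qed
qed

section \<open>Counting missing colours\<close>

lemma double_sum_split:
  fixes f :: "'a \<Rightarrow> 'a \<Rightarrow> int"
  assumes "finite V" "U \<subseteq> V" "\<And>u v. f u v = f v u"
  shows "(\<Sum>u\<in>V. \<Sum>v\<in>V. f u v) =
    2 * (\<Sum>u\<in>U. \<Sum>v\<in>V. f u v) - (\<Sum>u\<in>U. \<Sum>v\<in>U. f u v) + (\<Sum>u\<in>V-U. \<Sum>v\<in>V-U. f u v)"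
proof -
  have row: "(\<Sum>v\<in>V. f u v) = (\<Sum>v\<in>U. f u v) + (\<Sum>v\<in>V-U. f u v)" for u
    using sum.subset_diff[OF assms(2,1), of "f u"] by simp
  have "(\<Sum>u\<in>V. \<Sum>v\<in>V. f u v) = (\<Sum>u\<in>U. \<Sum>v\<in>V. f u v) + (\<Sum>u\<in>V-U. \<Sum>v\<in>V. f u v)"
    using sum.subset_diff[OF assms(2,1), of "\<lambda>u. sum (f u) V"] by simp
  moreover have "(\<Sum>u\<in>V-U. \<Sum>v\<in>V. f u v) = (\<Sum>u\<in>V-U. \<Sum>v\<in>U. f u v) + (\<Sum>u\<in>V-U. \<Sum>v\<in>V-U. f u v)"
    by (simp add: row sum.distrib)
  moreover have "(\<Sum>u\<in>V-U. \<Sum>v\<in>U. f u v) = (\<Sum>u\<in>U. \<Sum>v\<in>V-U. f u v)"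
    using assms(3) by (subst sum.swap) simp
  moreover have "(\<Sum>u\<in>U. \<Sum>v\<in>V. f u v) = (\<Sum>u\<in>U. \<Sum>v\<in>U. f u v) + (\<Sum>u\<in>U. \<Sum>v\<in>V-U. f u v)"
    by (simp add: row sum.distrib)
  ultimately show ?thesis by linarith
qed

lemma double_sum_le:
  fixes f :: "'a \<Rightarrow> 'a \<Rightarrow> int"
  assumes "finite U" "\<And>u. f u u = 0" "\<And>u v. f u v \<le> K"
  shows "(\<Sum>u\<in>U. \<Sum>v\<in>U. f u v) \<le> K * (int (card U) * (int (card U) - 1))"
proof -
  have "(\<Sum>v\<in>U. f u v) \<le> K * (int (card U) - 1)" if "u \<in> U" for u
  proof -
    have "(\<Sum>v\<in>U. f u v) = (\<Sum>v\<in>U-{u}. f u v)"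
      using sum.remove[OF assms(1) that, of "f u"] assms(2) by simp
    also have "\<dots> \<le> (\<Sum>v\<in>U-{u}. K)" by (intro sum_mono assms)
    also have "\<dots> = K * (int (card U) - 1)"
    proof -
      have "int (card (U - {u})) = int (card U) - 1" using card_Suc_Diff1[OF assms(1) that] by linarith
      then show ?thesis by (simp add: mult.commute del: card_Diff_insert card_Diff_singleton)
    qed
    finally show ?thesis .
  qed
  then have "(\<Sum>u\<in>U. \<Sum>v\<in>U. f u v) \<le> (\<Sum>u\<in>U. K * (int (card U) - 1))" by (rule sum_mono)
  then show ?thesis by (simp add: algebra_simps)
qed

text \<open>The rows and columns of \<open>U\<close> overlap only in the ordered pairs inside
  \<open>U\<close>, each of weight at most \<open>K\<close>.\<close>

lemma double_sum_incidence:
  fixes f :: "'a \<Rightarrow> 'a \<Rightarrow> int"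
  assumes "finite V" "U \<subseteq> V" "\<And>u v. f u v = f v u"
    and "\<And>u. f u u = 0" "\<And>u v. f u v \<le> K" "\<And>u v. 0 \<le> f u v"
  shows "2 * (\<Sum>u\<in>U. \<Sum>v\<in>V. f u v) \<le>
    (\<Sum>u\<in>V. \<Sum>v\<in>V. f u v) + K * (int (card U) * (int (card U) - 1))"
proof -
  have "0 \<le> (\<Sum>u\<in>V-U. \<Sum>v\<in>V-U. f u v)" by (intro sum_nonneg assms)
  moreover have "(\<Sum>u\<in>U. \<Sum>v\<in>U. f u v) \<le> K * (int (card U) * (int (card U) - 1))"
    using assms finite_subset by (intro double_sum_le) auto
  moreover note double_sum_split[of V U f, OF assms(1,2)] assms(3)
  ultimately show ?thesis by (smt (verit))
qed

section \<open>Weighted graphs and their losses\<close>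

locale wgraph =
  fixes V :: "'v set" and w :: "'v \<Rightarrow> 'v \<Rightarrow> nat" and c n :: nat
  assumes finV: "finite V" and cardV: "card V = n" and n9: "9 \<le> n" and c3: "3 \<le> c" and cn: "2 * c + 1 \<le> n"
    and w_sym: "w u v = w v u" and w_irrefl [simp]: "w u u = 0" and w_le: "w u v \<le> c"
begin

sublocale sgraph V "\<lambda>u v. 2 \<le> w u v"
  by unfold_locales (use finV w_sym in auto)

abbreviation S :: "'v \<Rightarrow> 'v \<Rightarrow> bool" where "S u v \<equiv> 2 \<le> w u v"

text \<open>The diagonal is 0 because absent loops do not count as missing.\<close>

definition loss :: "'v \<Rightarrow> 'v \<Rightarrow> int" where
  "loss u v = (if u = v then 0 else int c - int (w u v))"

definition nonS :: "'v \<Rightarrow> 'v \<Rightarrow> int" where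
  "nonS u v = of_bool (u \<noteq> v \<and> \<not> S u v)"

definition zer :: "'v \<Rightarrow> 'v \<Rightarrow> int" where
  "zer u v = of_bool (u \<noteq> v \<and> w u v = 0)"

text \<open>These pairs are strong but leave no third choice; a strong path without a pair of three
  colours consists of them alone.\<close>

definition two :: "'v \<Rightarrow> 'v \<Rightarrow> int" where
  "two u v = of_bool (w u v = 2)"

lemma loss_sym: "loss u v = loss v u"
  and nonS_sym: "nonS u v = nonS v u"
  and zer_sym: "zer u v = zer v u"
  and two_sym: "two u v = two v u"
  using w_sym[of u v] by (auto simp: loss_def nonS_def zer_def two_def)

lemma self [simp]: "loss u u = 0" "nonS u u = 0" "zer u u = 0" "two u u = 0"
  by (auto simp: loss_def nonS_def zer_def two_def)

lemma nonneg: "0 \<le> loss u v" "0 \<le> nonS u v" "0 \<le> zer u v" "0 \<le> two u v"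
  using w_le[of u v] by (auto simp: loss_def nonS_def zer_def two_def)

lemma upper: "loss u v \<le> int c" "nonS u v \<le> 1" "zer u v \<le> 1" "two u v \<le> 1"
  by (auto simp: loss_def nonS_def zer_def two_def)

text \<open>A pair that is not strong misses \<open>c - 1\<close> colours, and one more if it is
  empty; a pair with exactly two colours is strong and misses \<open>c - 2\<close>.\<close>

lemma loss_ge: "(int c - 1) * nonS u v + zer u v + (int c - 2) * two u v \<le> loss u v"
  using c3 w_le[of u v] by (auto simp: loss_def nonS_def zer_def two_def)

lemma sum_loss_ge:
  "(int c - 1) * (\<Sum>v\<in>A. nonS u v) + (\<Sum>v\<in>A. zer u v) + (int c - 2) * (\<Sum>v\<in>A. two u v)
    \<le> (\<Sum>v\<in>A. loss u v)"
  by (simp add: sum_distrib_left flip: sum.distrib) (intro sum_mono loss_ge)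

lemma double_sum_loss_ge:
  "(int c - 1) * (\<Sum>u\<in>A. \<Sum>v\<in>A. nonS u v) + (\<Sum>u\<in>A. \<Sum>v\<in>A. zer u v)
    + (int c - 2) * (\<Sum>u\<in>A. \<Sum>v\<in>A. two u v) \<le> (\<Sum>u\<in>A. \<Sum>v\<in>A. loss u v)"
  by (simp add: sum_distrib_left flip: sum.distrib) (intro sum_mono loss_ge)

definition D :: "'v \<Rightarrow> int" where
  "D u = (\<Sum>v\<in>V. loss u v)"

lemma sum_nonS:
  assumes "x \<in> V"
  shows "(\<Sum>v\<in>V. nonS x v) = int n - 1 - int (deg x)"
proof -
  have "(\<Sum>v\<in>V. nonS x v) = int (card {v \<in> V. x \<noteq> v \<and> \<not> S x v})"
    unfolding nonS_def using finV by (simp add: sum.If_cases Int_def)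
  moreover have "{v \<in> V. x \<noteq> v \<and> \<not> S x v} = V - insert x {v \<in> V. S x v}" by auto
  moreover have "card (V - insert x {v \<in> V. S x v}) = card V - card (insert x {v \<in> V. S x v})"
    using finV assms by (intro card_Diff_subset) auto
  moreover have "card (insert x {v \<in> V. S x v}) = Suc (deg x)"
    using finV by (simp add: deg_def)
  moreover have "Suc (deg x) \<le> card V"
    using card_mono[of V "insert x {v \<in> V. S x v}"] finV assms calculation(4) by auto
  ultimately show ?thesis using cardV by (simp add: of_nat_diff)
qed

lemma sum_zer_ge:
  assumes "X \<subseteq> A" "finite A" "x \<notin> X" "\<And>u. u \<in> X \<Longrightarrow> w x u = 0"
  shows "int (card X) \<le> (\<Sum>v\<in>A. zer x v)"
proof -
  have "\<And>v. v \<in> X \<Longrightarrow> zer x v = 1" using assms by (auto simp: zer_def)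
  then have "int (card X) = (\<Sum>v\<in>X. zer x v)" by simp
  also have "\<dots> \<le> (\<Sum>v\<in>A. zer x v)" using assms nonneg by (intro sum_mono2) auto
  finally show ?thesis .
qed

lemma D_ge:
  assumes "x \<in> V" shows "(int c - 1) * (int n - 1 - int (deg x)) + (\<Sum>v\<in>V. zer x v) \<le> D x"
proof -
  have "0 \<le> (int c - 2) * (\<Sum>v\<in>V. two x v)" using c3 nonneg by (auto intro!: mult_nonneg_nonneg sum_nonneg)
  then show ?thesis using sum_loss_ge[of x V] unfolding D_def sum_nonS[OF assms] by linarith
qed

lemma D_nonneg: "0 \<le> D x"
  unfolding D_def by (intro sum_nonneg nonneg)

end

text \<open>Here \<open>w u v\<close> is the number of colours between \<open>u\<close> and \<open>v\<close>. The assumptions \<open>stuck1\<close> and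
  \<open>stuck2\<close> exclude the Hamiltonian paths whose edges can be coloured whatever the colours are:
  all pairs carry two colours, except for one pair, or for two pairs that have a pair with three
  colours between them.\<close>

locale stuck_wgraph = wgraph +
  assumes not_isolated: "x \<in> V \<Longrightarrow> \<exists>u\<in>V. w x u \<noteq> 0"
    and loss_bound: "(\<Sum>u\<in>V. \<Sum>v\<in>V. loss u v) \<le> 2 * (int c * (2 * int n - 3) - int n)"
    and stuck1: "\<lbrakk>us \<noteq> []; vs \<noteq> []; distinct (us @ vs); set (us @ vs) = V;
       successively S us; successively S vs\<rbrakk> \<Longrightarrow> w (last us) (hd vs) = 0"
    and stuck2: "\<lbrakk>us \<noteq> []; vs \<noteq> []; ws \<noteq> []; distinct (us @ vs @ ws); set (us @ vs @ ws) = V;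
       successively S us; successively S vs; successively S ws;
       \<not> successively (\<lambda>u v. w u v \<le> 2) vs; w (last us) (hd vs) \<noteq> 0\<rbrakk> \<Longrightarrow> w (last vs) (hd ws) = 0"
begin

section \<open>Covers by one path, by at least four, and by two whose ends all have strong
  neighbours\<close>

lemma no_cov0: "\<nexists>vs. cov 0 vs"
proof
  assume "\<exists>vs. cov 0 vs"
  then obtain vs where "cov 0 vs" ..
  then obtain xs where xs: "distinct xs" "set xs = V" "successively S xs" by (rule cov0_split)
  then have "length xs = n" using cardV distinct_card by fastforce
  then obtain a b r where abr: "xs = a # b # r"
    using n9 by (cases xs; cases "tl xs") auto
  show False using stuck1[of "[a]" "b # r"] xs unfolding abr by auto
qed

lemma endp_in_V: "endp m x y \<Longrightarrow> x \<in> V \<and> y \<in> V"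
  unfolding endp_def by (metis hd_in_set last_in_set set_cov)

text \<open>Any edge between \<open>y\<close> and \<open>x\<close> would join the two strong paths
  of the cover to a path of the kind excluded by \<open>stuck1\<close>.\<close>

lemma endp1_zero: assumes "endp 1 x y" shows "w x y = 0"
proof -
  obtain vs where vs: "cov 1 vs" "hd vs = Some x" "last vs = Some y" using assms unfolding endp_def by blast
  obtain A B where AB: "vs = map Some A @ None # map Some B"
    "distinct (A @ B)" "set (A @ B) = V" "successively S A" "successively S B"
    using cov1_split[OF vs(1)] by blast
  have ne: "A \<noteq> []" "B \<noteq> []" using vs AB by (auto split: if_splits)
  then have "hd A = x" "last B = y" using vs AB by (auto simp: hd_map last_map)
  then show ?thesis using stuck1[of B A] ne AB w_sym[of x y] by (simp add: Un_commute inf_commute)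
qed

lemma nonS_bound: "(int c - 1) * (\<Sum>u\<in>V. \<Sum>v\<in>V. nonS u v) + (\<Sum>u\<in>V. \<Sum>v\<in>V. zer u v)
    + (int c - 2) * (\<Sum>u\<in>V. \<Sum>v\<in>V. two u v) \<le> 2 * (int c * (2 * int n - 3) - int n)"
  using double_sum_loss_ge[of V] loss_bound by linarith

text \<open>Rotation turns an end \<open>x\<close> with \<open>h\<close> strong neighbours into at least \<open>h + 3\<close> ends, none of which
  has more strong neighbours if the pair of ends is chosen with maximal degree sum.\<close>

lemma no_large_cover:
  assumes min: "\<nexists>vs. cov m vs" and ex: "cov (Suc m) vs" and m: "2 \<le> m"
  shows False
proof -
  have two: "2 \<le> card V" using n9 cardV by simp
  have "V \<noteq> {}" using n9 cardV by auto
  then obtain x0 y0 where e0: "endp (Suc m) x0 y0" using cov_ends[OF min ex] by blast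
  let ?P = "\<lambda>p. endp (Suc m) (fst p) (snd p)" and ?f = "\<lambda>p. deg (fst p) + deg (snd p)"
  have "\<forall>p. ?P p \<longrightarrow> ?f p \<le> card V"
    using endp_deg_sum[OF min _ two] by fastforce
  then obtain p where p: "?P p" "\<And>p'. ?P p' \<Longrightarrow> ?f p' \<le> ?f p"
    using e0 ex_has_greatest_nat[of ?P "(x0,y0)" ?f "card V"] by fastforce
  define x where "x = (if deg (fst p) \<le> deg (snd p) then fst p else snd p)"
  define y where "y = (if deg (fst p) \<le> deg (snd p) then snd p else fst p)"
  have xy: "endp (Suc m) x y" "deg x \<le> deg y" using p(1) endp_sym by (auto simp: x_def y_def)
  have best: "deg u + deg y \<le> deg x + deg y" if "endp (Suc m) u y" for u
    using p(2)[of "(u,y)"] that by (auto simp: x_def y_def)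
  obtain X where X: "X \<subseteq> V" "card X = deg x + Suc m" "\<And>u. u \<in> X \<Longrightarrow> endp (Suc m) u y"
    using rotation[OF _ xy(1) two] min by auto
  \<comment> \<open>As \<open>m\<close> is at least 2, there are at least \<open>deg x + 3\<close>
    rotated ends. Exactly that many are kept, so that the estimate depends on \<open>h\<close> and
    \<open>n\<close> only.\<close>
  obtain X0 where X0: "X0 \<subseteq> X" "card X0 = deg x + 3"
    using obtain_subset_with_card_n[of "deg x + 3" X] X(2) m by auto
  define h where "h = int (deg x)"
  define Q where "Q = (\<Sum>u\<in>V. \<Sum>v\<in>V. nonS u v)"
  have row: "int n - 1 - h \<le> (\<Sum>v\<in>V. nonS u v)" if "u \<in> X0" for u
    using sum_nonS[of u] best[of u] X X0 that unfolding h_def by force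
  have "(\<Sum>u\<in>X0. int n - 1 - h) \<le> (\<Sum>u\<in>X0. \<Sum>v\<in>V. nonS u v)" by (intro sum_mono row)
  then have "(h + 3) * (int n - 1 - h) \<le> (\<Sum>u\<in>X0. \<Sum>v\<in>V. nonS u v)" using X0(2) by (simp add: h_def)
  moreover have "2 * (\<Sum>u\<in>X0. \<Sum>v\<in>V. nonS u v) \<le> Q + 1 * (int (card X0) * (int (card X0) - 1))"
    unfolding Q_def using X X0 nonS_sym upper nonneg finV by (intro double_sum_incidence) auto
  ultimately have "(h + 3) * (2 * int n - 4 - 3 * h) \<le> Q"
    using X0(2) by (simp add: h_def algebra_simps)
  moreover have "2 * h \<le> int n - 4"
    using endp_deg_sum[OF min xy(1) two] xy(2) m cardV unfolding h_def by linarith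
  moreover have "(int c - 1) * Q \<le> 2 * (int c * (2 * int n - 3) - int n)"
  proof -
    have "0 \<le> (\<Sum>u\<in>V. \<Sum>v\<in>V. zer u v)" "0 \<le> (int c - 2) * (\<Sum>u\<in>V. \<Sum>v\<in>V. two u v)"
      using nonneg c3 by (auto intro!: sum_nonneg mult_nonneg_nonneg)
    then show ?thesis using nonS_bound unfolding Q_def by linarith
  qed
  ultimately show False using arith_k4[of "int c" "int n" h Q] c3 n9 by (auto simp: h_def)
qed

lemma endp1_rotation:
  assumes "endp 1 x y"
  obtains X where "X \<subseteq> V" "x \<in> X" "y \<notin> X" "card X = deg x + 1" "\<And>u. u \<in> X \<Longrightarrow> endp 1 u y"
    "\<And>u. u \<in> X \<Longrightarrow> w u y = 0"
proof -
  have two: "2 \<le> card V" using n9 cardV by simp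
  obtain X where X: "X \<subseteq> V" "x \<in> X" "y \<notin> X" "card X = deg x + 1" "\<And>u. u \<in> X \<Longrightarrow> endp 1 u y"
    using rotation[OF _ assms two] no_cov0 by auto
  show thesis by (rule that[of X]) (use X endp1_zero in auto)
qed

text \<open>For covers by two paths the rotated ends see the opposite end in no colour at all. Choosing the
  pair of ends with the least total loss makes every rotated end at least as expensive.\<close>

lemma cover2_isolated:
  assumes "cov 1 vs"
  shows "\<exists>x y. endp 1 x y \<and> deg x = 0"
proof (rule ccontr)
  assume "\<not> ?thesis"
  then have pos: "deg x \<noteq> 0" "deg y \<noteq> 0" if "endp 1 x y" for x y
    using that endp_sym[OF that] by auto
  have "V \<noteq> {}" using n9 cardV by auto
  then obtain x0 y0 where e0: "endp 1 x0 y0" using cov_ends[of 0 vs] no_cov0 assms by auto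
  let ?P = "\<lambda>p. endp 1 (fst p) (snd p)" and ?f = "\<lambda>p. nat (D (fst p) + D (snd p))"
  obtain p where p: "?P p" "\<And>p'. ?P p' \<Longrightarrow> ?f p \<le> ?f p'"
    using e0 ex_has_least_nat[of ?P "(x0,y0)" ?f] by fastforce
  define x where "x = (if deg (fst p) \<le> deg (snd p) then fst p else snd p)"
  define y where "y = (if deg (fst p) \<le> deg (snd p) then snd p else fst p)"
  have xy: "endp 1 x y" "deg x \<le> deg y" using p(1) endp_sym by (auto simp: x_def y_def)
  have best: "D x \<le> D u" if "endp 1 u y" for u
    using p(2)[of "(u,y)"] that D_nonneg[of u] D_nonneg[of x] D_nonneg[of y]
    by (auto simp: x_def y_def split: if_splits)
  obtain X where X: "X \<subseteq> V" "x \<in> X" "y \<notin> X" "card X = deg x + 1" "\<And>u. u \<in> X \<Longrightarrow> endp 1 u y"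
     "\<And>u. u \<in> X \<Longrightarrow> w u y = 0" using endp1_rotation[OF xy(1)] by blast
  obtain Y where Y: "Y \<subseteq> V" "y \<in> Y" "x \<notin> Y" "card Y = deg y + 1" "\<And>u. u \<in> Y \<Longrightarrow> w u x = 0"
    using endp1_rotation[OF endp_sym[OF xy(1)]] by metis
  have V: "x \<in> V" "y \<in> V" using X Y by auto
  define p' where "p' = int (deg x)"
  define q where "q = int (deg y)"
  \<comment> \<open>Ends rotated from \<open>y\<close> stay opposite to \<open>x\<close>, so
    \<open>x\<close> has no edge to any of the \<open>q + 1\<close> vertices of \<open>Y\<close>;
    each costs one colour beyond the \<open>c - 1\<close> of a pair that is not strong.\<close>
  have "int (card Y) \<le> (\<Sum>v\<in>V. zer x v)" using Y w_sym finV by (intro sum_zer_ge) auto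
  then have Dx: "(int c - 1) * (int n - 1 - p') + q + 1 \<le> D x"
    using D_ge[OF V(1)] Y(4) by (simp add: p'_def q_def)
  have "int (card X) \<le> (\<Sum>v\<in>V. zer y v)" using X w_sym finV by (intro sum_zer_ge) auto
  then have Dy: "(int c - 1) * (int n - 1 - q) + p' + 1 \<le> D y"
    using D_ge[OF V(2)] X(4) by (simp add: p'_def q_def)
  have fX: "finite X" using X finV finite_subset by blast
  have "2 * (\<Sum>u\<in>insert y X. \<Sum>v\<in>V. loss u v) \<le> (\<Sum>u\<in>V. \<Sum>v\<in>V. loss u v)
      + int c * (int (card (insert y X)) * (int (card (insert y X)) - 1))"
    using X V loss_sym upper nonneg finV by (intro double_sum_incidence) auto
  moreover have "card (insert y X) = deg x + 2" using X fX by simp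
  moreover have "(\<Sum>u\<in>insert y X. \<Sum>v\<in>V. loss u v) = D y + (\<Sum>u\<in>X. D u)"
    using X fX by (simp add: D_def)
  moreover have "(\<Sum>u\<in>X. D x) \<le> (\<Sum>u\<in>X. D u)" by (intro sum_mono best X)
  then have "(p' + 1) * D x \<le> (\<Sum>u\<in>X. D u)" using X(4) by (simp add: p'_def algebra_simps)
  moreover have "(p' + 1) * ((int c - 1) * (int n - 1 - p') + q + 1) \<le> (p' + 1) * D x"
    using Dx by (intro mult_left_mono) (auto simp: p'_def)
  ultimately have "2 * ((p' + 1) * ((int c - 1) * (int n - 1 - p') + q + 1) + (int c - 1) * (int n - 1 - q) + p' + 1)
     \<le> 2 * (int c * (2 * int n - 3) - int n) + int c * ((p' + 2) * (p' + 1))"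
    using Dy loss_bound by (simp add: p'_def algebra_simps)
  moreover have "1 \<le> p'" "p' \<le> q" using pos[OF xy(1)] xy(2) by (auto simp: p'_def q_def)
  moreover have "p' + q \<le> int n - 2"
    using endp_deg_sum[of 0 x y] no_cov0 xy(1) n9 cardV by (auto simp: p'_def q_def)
  ultimately show False using arith_k2[of "int c" "int n" p' q] c3 n9 cn by auto
qed

end

section \<open>Covers by two paths\<close>

lemma double_sum_mono_set:
  fixes f :: "'a \<Rightarrow> 'a \<Rightarrow> int"
  assumes "finite V" "U \<subseteq> V" "\<And>u v. 0 \<le> f u v"
  shows "(\<Sum>u\<in>U. \<Sum>v\<in>U. f u v) \<le> (\<Sum>u\<in>V. \<Sum>v\<in>V. f u v)"
proof -
  have "(\<Sum>u\<in>U. \<Sum>v\<in>U. f u v) \<le> (\<Sum>u\<in>U. \<Sum>v\<in>V. f u v)"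
    using assms by (intro sum_mono sum_mono2) auto
  also have "\<dots> \<le> (\<Sum>u\<in>V. \<Sum>v\<in>V. f u v)"
    using assms by (intro sum_mono2 sum_nonneg) auto
  finally show ?thesis .
qed

lemma double_sum_path:
  fixes f :: "'a \<Rightarrow> 'a \<Rightarrow> int"
  assumes f: "\<And>u v. f u v = f v u" "\<And>u. f u u = 0" "\<And>u v. 0 \<le> f u v"
    and "distinct xs" "successively (\<lambda>u v. 1 \<le> f u v) xs" "xs \<noteq> []"
  shows "2 * (int (length xs) - 1) \<le> (\<Sum>u\<in>set xs. \<Sum>v\<in>set xs. f u v)"
  using assms(4-6)
proof (induction xs)
  case (Cons a xs)
  have "(\<Sum>u\<in>set (a # xs). \<Sum>v\<in>set (a # xs). f u v) = 2 * (\<Sum>u\<in>{a}. \<Sum>v\<in>set (a # xs). f u v)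
      - (\<Sum>u\<in>{a}. \<Sum>v\<in>{a}. f u v) + (\<Sum>u\<in>set (a # xs)-{a}. \<Sum>v\<in>set (a # xs)-{a}. f u v)"
    by (rule double_sum_split) (use f in auto)
  moreover have "set (a # xs) - {a} = set xs" using Cons.prems by auto
  ultimately have eq: "(\<Sum>u\<in>set (a # xs). \<Sum>v\<in>set (a # xs). f u v) =
      2 * (\<Sum>v\<in>set (a # xs). f a v) + (\<Sum>u\<in>set xs. \<Sum>v\<in>set xs. f u v)"
    using f(2) by simp
  show ?case
  proof (cases "xs = []")
    case False
    then have "1 \<le> f a (hd xs)" "successively (\<lambda>u v. 1 \<le> f u v) xs"
      using Cons.prems by (auto simp: successively_Cons)
    moreover have "f a (hd xs) \<le> (\<Sum>v\<in>set (a # xs). f a v)"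
      using False f by (intro member_le_sum) auto
    ultimately show ?thesis using Cons.IH Cons.prems False eq by auto
  qed (use f in auto)
qed auto

lemma (in wgraph) successively_flip [simp]:
  "successively (\<lambda>u v. 2 \<le> w v u) xs \<longleftrightarrow> successively S xs"
  "successively (\<lambda>u v. w v u \<le> 2) xs \<longleftrightarrow> successively (\<lambda>u v. w u v \<le> 2) xs"
  using w_sym by simp_all

context stuck_wgraph
begin

lemma deg_0D:
  assumes "deg x = 0" "v \<in> V" shows "\<not> S x v"
proof
  assume "S x v"
  then have "v \<in> {u \<in> V. S x u}" using assms by simp
  moreover have "finite {u \<in> V. S x u}" using finV by simp
  ultimately show False using assms(1) card_0_eq unfolding deg_def by blast
qed

lemma isolated_path:
  assumes "endp 1 x y" "deg x = 0"
  obtains bs where "bs \<noteq> []" "hd bs = y" "distinct bs" "set bs = V - {x}" "successively S bs"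
proof -
  obtain vs where vs: "cov 1 vs" "hd vs = Some x" "last vs = Some y" using assms(1) unfolding endp_def by blast
  obtain A B where AB: "vs = map Some A @ None # map Some B"
    "distinct (A @ B)" "set (A @ B) = V" "successively S A" "successively S B"
    using cov1_split[OF vs(1)] by blast
  have ne: "A \<noteq> []" "B \<noteq> []" using vs AB by (auto split: if_splits)
  then have hl: "hd A = x" "last B = y" using vs AB by (auto simp: hd_map last_map)
  obtain A' where A': "A = x # A'" using ne hl by (cases A) auto
  have "A' = []"
  proof (rule ccontr)
    assume "A' \<noteq> []"
    then have "S x (hd A')" "hd A' \<in> V" using AB A' by (auto simp: successively_Cons)
    then show False using deg_0D[OF assms(2)] by blast
  qed
  then have A: "A = [x]" using A' by simp
  show thesis
    by (rule that[of "rev B"]) (use ne hl AB A in \<open>auto simp: hd_rev\<close>)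
qed

text \<open>Here \<open>x\<close> is a path of its own, and \<open>y\<close> starts a strong path
  through all other vertices. From \<open>x\<close> one may enter that path at a neighbour
  \<open>a\<close>, run back to \<open>y\<close> and jump to the successor of \<open>a\<close>. So
  \<open>y\<close> has no strong pair with such a successor, and sees one at all only if
  \<open>y\<close> has a pair with exactly two colours. Either way \<open>y\<close> loses the extra
  amount \<open>z\<close>.\<close>

lemma not_cover2:
  assumes e0: "endp 1 x y0" and x0: "deg x = 0"
  shows False
proof -
  obtain y where y: "endp 1 x y" and ymin: "\<And>u. endp 1 x u \<Longrightarrow> D y \<le> D u"
  proof -
    have "\<exists>y. endp 1 x y \<and> (\<forall>u. endp 1 x u \<longrightarrow> nat (D y) \<le> nat (D u))"
      by (rule ex_has_least_nat[of "endp 1 x" y0 "\<lambda>u. nat (D u)", OF e0])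
    then obtain y where y: "endp 1 x y" "\<And>u. endp 1 x u \<Longrightarrow> nat (D y) \<le> nat (D u)" by blast
    show thesis
    proof (rule that[of y])
      show "D y \<le> D u" if "endp 1 x u" for u
        using y(2)[OF that] D_nonneg[of u] by (simp add: nat_le_eq_zle)
    qed (rule y)
  qed
  have xV: "x \<in> V" and yV: "y \<in> V" using endp_in_V[OF y] by auto
  have notS: "\<not> S x v" if "v \<in> V" for v
    using deg_0D[OF x0 that] .
  define W where "W = V - {x}"
  have fW: "finite W" using finV by (simp add: W_def)
  define Nx where "Nx = {a \<in> V. w x a \<noteq> 0}"
  define d where "d = card Nx"
  define q where "q = deg y"
  define e where "e = int n - 2 - int q"
  have NxW: "Nx \<subseteq> W" by (auto simp: Nx_def W_def)
  have d1: "1 \<le> d"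
    using not_isolated[OF xV] finV unfolding d_def Nx_def by (auto simp: Suc_le_eq card_gt_0_iff)
  obtain Y where Y: "Y \<subseteq> V" "y \<in> Y" "x \<notin> Y" "card Y = q + 1" "\<And>u. u \<in> Y \<Longrightarrow> endp 1 u x"
    "\<And>u. u \<in> Y \<Longrightarrow> w u x = 0"
    using endp1_rotation[OF endp_sym[OF y]] unfolding q_def by metis
  have cardW: "card W = n - 1" using xV cardV by (simp add: W_def)
  have YW: "Y \<subseteq> W" using Y by (auto simp: W_def)
  have fY: "finite Y" using YW fW finite_subset by blast
  have cardZ: "card (W - Nx) = n - 1 - d"
    using card_Diff_subset[OF finite_subset[OF NxW fW] NxW] cardW by (simp add: d_def)
  have dle: "d \<le> n - 1" using card_mono[OF fW NxW] cardW by (simp add: d_def)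
  have "Y \<subseteq> W - Nx" using YW Y(6) w_sym by (auto simp: Nx_def)
  then have "q + 1 \<le> n - 1 - d" using card_mono[of "W - Nx" Y] fW Y(4) cardZ by simp
  then have ed: "int d \<le> e" using n9 by (simp add: e_def)
  have "int (card (W - Nx)) \<le> (\<Sum>v\<in>V. zer x v)"
    by (rule sum_zer_ge) (use finV in \<open>auto simp: W_def Nx_def\<close>)
  then have "int n - 1 - int d \<le> (\<Sum>v\<in>V. zer x v)" using cardZ dle n9 by simp
  then have Dx: "int c * (int n - 1) - int d \<le> D x" using D_ge[OF xV] x0 by (simp add: algebra_simps)
  define Lx where "Lx = (\<Sum>u\<in>W. \<Sum>v\<in>W. loss u v)"
  have "(\<Sum>u\<in>V. \<Sum>v\<in>V. loss u v) = 2 * (\<Sum>u\<in>{x}. \<Sum>v\<in>V. loss u v) -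
     (\<Sum>u\<in>{x}. \<Sum>v\<in>{x}. loss u v) + (\<Sum>u\<in>V-{x}. \<Sum>v\<in>V-{x}. loss u v)"
    by (rule double_sum_split) (use finV xV loss_sym in auto)
  then have "(\<Sum>u\<in>V. \<Sum>v\<in>V. loss u v) = 2 * D x + Lx" by (simp add: D_def Lx_def W_def)
  then have Lx: "Lx \<le> 2 * (int c * (int n - 2) - int n + int d)"
    using loss_bound Dx by (simp add: algebra_simps)
  define D' where "D' u = (\<Sum>v\<in>W. loss u v)" for u
  have D': "D u = D' u + loss u x" for u
    using sum.remove[OF finV xV, of "loss u"] by (simp add: D_def D'_def W_def)
  \<comment> \<open>\<open>y\<close> was chosen by its loss in the whole graph. Every vertex of
    \<open>Y\<close> misses all \<open>c\<close> colours to \<open>x\<close>, so the comparison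
    survives the removal of \<open>x\<close>.\<close>
  have D'Y: "D' y \<le> D' u" if "u \<in> Y" for u
  proof -
    have "loss v x = int c" if "v \<in> Y" for v using Y(3,6) that by (auto simp: loss_def)
    then show ?thesis using D'[of u] D'[of y] ymin[OF endp_sym[OF Y(5)[OF that]]] that Y(2) by simp
  qed
  have "(\<Sum>u\<in>Y. D' y) \<le> (\<Sum>u\<in>Y. D' u)" by (intro sum_mono D'Y)
  then have sumY: "(int q + 1) * D' y \<le> (\<Sum>u\<in>Y. D' u)" using Y(4) by (simp add: algebra_simps)
  have incY: "2 * (\<Sum>u\<in>Y. D' u) \<le> Lx + int c * ((int q + 1) * int q)"
    using double_sum_incidence[OF fW YW loss_sym self(1) upper(1) nonneg(1)] Y(4)
    by (simp add: D'_def Lx_def algebra_simps)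
  have "(\<Sum>u\<in>Y. D' u) \<le> (\<Sum>u\<in>W. D' u)"
    using fW YW by (intro sum_mono2) (auto simp: D'_def intro!: sum_nonneg nonneg)
  then have halfY: "(int q + 1) * D' y \<le> Lx" using sumY by (simp add: Lx_def D'_def)
  have yW: "y \<in> W" using Y YW by auto
  \<comment> \<open>Of the \<open>n - 1 - q\<close> vertices without a strong pair to
    \<open>y\<close>, one is \<open>x\<close>, which lies outside \<open>W\<close>.\<close>
  have nonSy: "(\<Sum>v\<in>W. nonS y v) = e"
    using sum.remove[OF finV xV, of "nonS y"] sum_nonS[OF yV] notS[OF yV] w_sym[of x y] yW
    by (simp add: W_def e_def q_def nonS_def)
  obtain bs where bs: "bs \<noteq> []" "hd bs = y" "distinct bs" "set bs = W" "successively S bs"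
    using isolated_path[OF y x0] unfolding W_def by blast
  have lenbs: "length bs = n - 1" using bs distinct_card cardW by fastforce
  have b0: "bs ! 0 = y" using bs by (simp add: hd_conv_nth)
  have wxy: "w x y = 0" using endp1_zero[OF y] .
  have nxt: "0 < j" "Suc j < length bs" "\<not> S y (bs ! Suc j)"
    "w y (bs ! Suc j) \<noteq> 0 \<Longrightarrow> \<exists>v\<in>W. two y v = 1"
    if j: "j < length bs" "w x (bs ! j) \<noteq> 0" for j
  proof -
    define B1 where "B1 = take j bs"
    define B2 where "B2 = drop (Suc j) bs"
    define a where "a = bs ! j"
    have split: "bs = B1 @ a # B2" using j id_take_nth_drop by (auto simp: B1_def B2_def a_def)
    have wa: "w x a \<noteq> 0" using j by (simp add: a_def)
    show j0: "0 < j" using j wxy b0 by (cases j) auto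
    have B1: "B1 \<noteq> []" "hd B1 = y" using j0 j bs by (auto simp: B1_def)
    have S: "successively S (rev B1)" "successively S B2" "S a (last B1)" "B2 \<noteq> [] \<Longrightarrow> S a (hd B2)"
      using bs(5) B1 w_sym unfolding split by (auto simp: successively_append_iff successively_Cons)
    have dis: "distinct B1" "distinct B2" "a \<notin> set B1" "a \<notin> set B2" "set B1 \<inter> set B2 = {}"
      using bs(3) unfolding split by auto
    have setV: "insert x (insert a (set B1 \<union> set B2)) = V" "x \<notin> insert a (set B1 \<union> set B2)"
      using bs(4) xV unfolding split W_def by auto
    have B2: "B2 \<noteq> []"
    proof
      assume "B2 = []"
      then show False using stuck1[of "[x]" "a # rev B1"] S B1 dis setV wa
        by (auto simp: successively_Cons hd_rev)
    qed
    then show sj: "Suc j < length bs" by (simp add: B2_def)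
    have hdB2: "hd B2 = bs ! Suc j" using sj by (simp add: B2_def hd_drop_conv_nth)
    show "\<not> S y (bs ! Suc j)"
    proof
      assume "S y (bs ! Suc j)"
      then show False using stuck1[of "[x]" "a # rev B1 @ B2"] S B1 B2 dis setV wa hdB2
        by (auto simp: successively_Cons successively_append_iff hd_rev hd_append last_rev)
    qed
    \<comment> \<open>Both joins are now non-empty, so by \<open>stuck2\<close> the stretch from
      \<open>a\<close> back to \<open>y\<close> has no pair of three colours; its last pair contains
      \<open>y\<close>.\<close>
    assume nz: "w y (bs ! Suc j) \<noteq> 0"
    have "successively (\<lambda>u v. w u v \<le> 2) (a # rev B1)"
    proof (rule ccontr)
      assume "\<not> ?thesis"
      then show False using stuck2[of "[x]" "a # rev B1" B2] S B1 B2 dis setV wa hdB2 nz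
        by (auto simp: successively_Cons hd_rev hd_append last_rev)
    qed
    moreover have "successively S (a # rev B1)" using S B1 by (auto simp: successively_Cons hd_rev)
    moreover obtain B1' where "B1 = y # B1'" using B1 by (cases B1) auto
    then have eq: "a # rev B1 = (a # rev B1') @ [y]" by simp
    ultimately have "w (last (a # rev B1')) y = 2"
      unfolding eq successively_append_iff by (auto intro: le_antisym)
    moreover have "last (a # rev B1') \<in> W"
      using \<open>B1 = y # B1'\<close> bs(4) split last_in_set[of "a # rev B1'"] by auto
    ultimately show "\<exists>v\<in>W. two y v = 1" using w_sym[of y] by (auto simp: two_def)
  qed
  define J where "J = {j. j < length bs \<and> w x (bs ! j) \<noteq> 0}"
  have cardJ: "card J = d"
  proof -
    have "Nx = {a \<in> set bs. w x a \<noteq> 0}" using NxW bs(4) unfolding Nx_def W_def by auto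
    then have "(\<lambda>j. bs ! j) ` J = Nx" unfolding J_def by (auto simp: in_set_conv_nth image_iff)
    moreover have "inj_on (\<lambda>j. bs ! j) J" by (rule inj_on_nth[OF bs(3)]) (auto simp: J_def)
    ultimately show ?thesis unfolding d_def by (metis card_image)
  qed
  define z where "z = (\<Sum>v\<in>W. zer y v) + (int c - 2) * (\<Sum>v\<in>W. two y v)"
  have D'y: "(int c - 1) * e + z \<le> D' y"
    using sum_loss_ge[of y W] nonSy unfolding z_def D'_def by simp
  have zge: "int d \<le> z \<or> int c - 2 \<le> z"
  proof (cases "\<exists>v\<in>W. two y v = 1")
    case True
    then obtain v where v: "v \<in> W" "two y v = 1" by blast
    have "1 \<le> (\<Sum>v\<in>W. two y v)" using member_le_sum[OF v(1), of "two y"] v(2) nonneg(4) fW by simp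
    then have "(int c - 2) * 1 \<le> (int c - 2) * (\<Sum>v\<in>W. two y v)" using c3 by (intro mult_left_mono) auto
    moreover have "0 \<le> (\<Sum>v\<in>W. zer y v)" by (intro sum_nonneg nonneg)
    ultimately have "0 + (int c - 2) * 1 \<le> z" unfolding z_def by (intro add_mono)
    then have "int c - 2 \<le> z" by simp
    then show ?thesis ..
  next
    case False
    have "int (card ((\<lambda>j. bs ! Suc j) ` J)) \<le> (\<Sum>v\<in>W. zer y v)"
    proof (rule sum_zer_ge)
      show "(\<lambda>j. bs ! Suc j) ` J \<subseteq> W" using nxt(2) bs(4) unfolding J_def by auto
      show "y \<notin> (\<lambda>j. bs ! Suc j) ` J"
        using nxt(2) b0 bs(3) bs(1) nth_eq_iff_index_eq[of bs 0] unfolding J_def by fastforce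
      show "w y u = 0" if "u \<in> (\<lambda>j. bs ! Suc j) ` J" for u using that nxt(4) False unfolding J_def by auto
    qed (use fW in auto)
    moreover have "inj_on (\<lambda>j. bs ! Suc j) J"
    proof (rule inj_onI)
      fix i k assume ik: "i \<in> J" "k \<in> J" "bs ! Suc i = bs ! Suc k"
      then have "Suc i < length bs" "Suc k < length bs" using nxt(2) by (auto simp: J_def)
      then show "i = k" using nth_eq_iff_index_eq[OF bs(3)] ik(3) by blast
    qed
    moreover have "0 \<le> (int c - 2) * (\<Sum>v\<in>W. two y v)" using c3 nonneg by (auto intro!: mult_nonneg_nonneg sum_nonneg)
    ultimately have "int d + 0 \<le> z" using cardJ unfolding z_def by (intro add_mono) (simp_all add: card_image)
    then have "int d \<le> z" by simp
    then show ?thesis ..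
  qed
  have z0: "0 \<le> z" using c3 nonneg unfolding z_def by (auto intro!: add_nonneg_nonneg mult_nonneg_nonneg sum_nonneg)
  have De: "(int c - 1) * e \<le> D' y" using D'y z0 by simp
  have "bs ! 1 \<in> {u \<in> V. S y u}"
    using bs(4,5) b0 lenbs n9 nth_mem[of 1 bs] successively_nth[of S bs 0] by (auto simp: W_def)
  then have q1: "1 \<le> q" unfolding q_def deg_def using finV by (auto simp: Suc_le_eq card_gt_0_iff)
  consider "q = 1" | "q = 2" | "3 \<le> q" "2 \<le> e" | "e = 1" using q1 ed d1 by linarith
  then show False
  proof cases
    case 1
    then show False using arith_iso_small1[of "int c" "int n" "int d" "D' y"] c3 n9 ed De sumY incY Lx by (simp add: e_def)
  next
    case 2
    then show False using arith_iso_small2[of "int c" "int n" "int d" "D' y"] c3 n9 ed De sumY incY Lx by (simp add: e_def)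
  next
    case 3
    then show False using arith_iso[of "int c" "int n" "int d" e "int q" z "D' y"] c3 n9 cn d1 ed zge D'y halfY Lx
      by (simp add: e_def)
  next
    case 4
    \<comment> \<open>For \<open>e = 1\<close> the row estimate no longer exceeds the bound on
      \<open>Lx\<close>, so the structure is used: \<open>y\<close> is strongly joined to all of
      \<open>W\<close> except \<open>s\<close>, the successor of the only neighbour \<open>a\<close>
      of \<open>x\<close>.\<close>
    then have d: "d = 1" using ed d1 by simp
    then obtain j where J: "J = {j}" using cardJ card_1_singletonE by metis
    then have j: "j < length bs" "w x (bs ! j) \<noteq> 0" by (auto simp: J_def)
    define B1 where "B1 = take j bs"
    define B2 where "B2 = drop (Suc j) bs"
    define a where "a = bs ! j"
    define s where "s = bs ! Suc j"
    have split: "bs = B1 @ a # B2" using j id_take_nth_drop by (auto simp: B1_def B2_def a_def)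
    have wa: "w x a \<noteq> 0" using j by (simp add: a_def)
    have B1: "B1 \<noteq> []" "hd B1 = y" using nxt(1)[OF j] j bs by (auto simp: B1_def)
    have B2: "B2 \<noteq> []" "hd B2 = s" using nxt(2)[OF j] by (auto simp: B2_def s_def hd_drop_conv_nth)
    have dis: "distinct B1" "distinct B2" "a \<notin> set B1" "a \<notin> set B2" "set B1 \<inter> set B2 = {}"
      using bs(3) unfolding split by auto
    have setW: "insert a (set B1 \<union> set B2) = W" using bs(4) unfolding split by auto
    have setV: "insert x (insert a (set B1 \<union> set B2)) = V" "x \<notin> insert a (set B1 \<union> set B2)"
      using setW xV unfolding W_def by auto
    have suc: "successively S B1" "successively S B2" "S (last B1) a"
      using bs(5) B1 unfolding split by (auto simp: successively_append_iff successively_Cons)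
    have sW: "s \<in> W" "s \<noteq> y"
      using B1 B2 setW dis hd_in_set[OF B1(1)] hd_in_set[OF B2(1)] by auto
    have ys: "nonS y s = 1" using nxt(3)[OF j] sW by (simp add: nonS_def s_def)
    have Sy: "S y v" if "v \<in> W" "v \<noteq> y" "v \<noteq> s" for v
    proof -
      have "(\<Sum>v\<in>W-{s}. nonS y v) = 0" using sum.remove[OF fW sW(1), of "nonS y"] nonSy 4 ys by simp
      moreover have "nonS y v \<le> (\<Sum>v\<in>W-{s}. nonS y v)"
        using that fW nonneg by (intro member_le_sum) auto
      ultimately have "nonS y v \<le> 0" by simp
      then show ?thesis using that by (cases "S y v") (auto simp: nonS_def)
    qed
    have B2s: "B2 = [s]"
    proof (rule ccontr)
      assume ne: "B2 \<noteq> [s]"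
      then obtain r where r: "B2 = s # r" "r \<noteq> []" using B2 by (cases B2) auto
      have "last B2 \<in> set B2" "last B2 \<noteq> s" using r dis(2) by auto
      moreover have "y \<in> set B1" using B1 hd_in_set[OF B1(1)] by simp
      ultimately have "S y (last B2)" using Sy[of "last B2"] setW dis(5) by (metis UnCI disjoint_iff insertCI)
      then show False using stuck1[of "[x]" "a # rev B1 @ rev B2"] suc B1 B2 dis setV wa w_sym
        by (auto simp: successively_Cons successively_append_iff hd_rev hd_append last_rev)
    qed
    have split': "bs = B1 @ [a, s]" using split B2s by simp
    have dis': "s \<notin> set B1" "s \<noteq> a" using dis B2s by auto
    \<comment> \<open>The path can be rerouted at any \<open>u\<close> of \<open>B1\<close>: from
      \<open>a\<close> back to the successor of \<open>u\<close>, across to \<open>y\<close>, then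
      forward to \<open>u\<close>. Thus every such \<open>u\<close> can be the last vertex before
      \<open>s\<close>.\<close>
    have step: "\<not> S u s" "w u s \<noteq> 0 \<Longrightarrow> \<exists>vs. distinct vs \<and> set vs = W - {s} \<and> successively S vs \<and>
          successively (\<lambda>u v. w u v \<le> 2) vs \<and> vs \<noteq> []" if u: "u \<in> set B1" for u
    proof -
      obtain P R where PR: "B1 = P @ u # R" using u by (meson split_list)
      define vs where "vs = a # rev R @ P @ [u]"
      have hdP: "hd (P @ [u]) = y" using B1 PR by (cases P) auto
      have "hd (R @ [a]) \<in> W" "hd (R @ [a]) \<noteq> y" "hd (R @ [a]) \<noteq> s"
      proof -
        have "hd (R @ [a]) \<in> set (R @ [a])" by (rule hd_in_set) simp
        moreover have "y \<in> set (P @ [u])" using hdP hd_in_set[of "P @ [u]"] by simp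
        ultimately show "hd (R @ [a]) \<in> W" "hd (R @ [a]) \<noteq> y" "hd (R @ [a]) \<noteq> s"
          using setW dis dis' PR by auto
      qed
      then have Sl: "S (hd (R @ [a])) y" using Sy w_sym by metis
      have "successively S (R @ [a])" "successively S (P @ [u])"
        using suc PR by (auto simp: successively_append_iff successively_Cons split: if_splits)
      then have sv: "successively S (rev (R @ [a]) @ (P @ [u]))"
        using Sl hdP by (subst successively_append_iff) (simp del: rev_append add: last_rev)
      then have sv: "successively S vs" by (simp add: vs_def)
      have dv: "distinct vs" "set vs = W - {s}" "last vs = u" "hd vs = a"
        using dis dis' PR setW B2s by (auto simp: vs_def)
      have Vs: "insert x (insert s (set vs)) = V" "x \<notin> set vs" "x \<noteq> s" "s \<notin> set vs"
        using dv sW xV by (auto simp: W_def)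
      have vne: "vs \<noteq> []" by (simp add: vs_def)
      show "\<not> S u s"
      proof
        assume "S u s"
        then show False using stuck1[of "[x]" "vs @ [s]"] sv dv(1,3,4) Vs vne wa
          by (auto simp: successively_append_iff)
      qed
      show "\<exists>vs. distinct vs \<and> set vs = W - {s} \<and> successively S vs \<and>
          successively (\<lambda>u v. w u v \<le> 2) vs \<and> vs \<noteq> []" if "w u s \<noteq> 0"
      proof (intro exI conjI)
        show "successively (\<lambda>u v. w u v \<le> 2) vs"
        proof (rule ccontr)
          assume "\<not> ?thesis"
          then show False using stuck2[of "[x]" vs "[s]"] sv dv(1,3,4) Vs vne wa that by auto
        qed
      qed (use dv sv in \<open>auto simp: vs_def\<close>)
    qed
    have lenB1: "length B1 = n - 3" using lenbs split' by simp
    then have cB1: "int (card (set B1)) = int n - 3" using dis(1) n9 by (simp add: distinct_card)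
    have B1W: "set B1 \<subseteq> W" using setW by auto
    show False
    \<comment> \<open>If some \<open>u\<close> sees \<open>s\<close>, a path through
      \<open>W - {s}\<close> has only pairs of exactly two colours, and \<open>s\<close> still has
      no strong pair with \<open>B1\<close>. Otherwise \<open>s\<close> misses every colour to
      \<open>B1\<close>. Both exceed the bound on \<open>Lx\<close>.\<close>
    proof (cases "\<exists>u\<in>set B1. w u s \<noteq> 0")
      case True
      then obtain vs where vs: "distinct vs" "set vs = W - {s}" "successively S vs"
          "successively (\<lambda>u v. w u v \<le> 2) vs" "vs \<noteq> []" using step(2) by blast
      have "successively (\<lambda>u v. 1 \<le> two u v) vs"
        using vs(3,4) by (auto simp: successively_conv_nth two_def intro!: le_antisym)
      then have "2 * (int (length vs) - 1) \<le> (\<Sum>u\<in>set vs. \<Sum>v\<in>set vs. two u v)"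
        using vs two_sym nonneg by (intro double_sum_path) auto
      also have "\<dots> \<le> (\<Sum>u\<in>W. \<Sum>v\<in>W. two u v)"
        using vs(2) fW nonneg by (intro double_sum_mono_set) auto
      finally have tw: "2 * (int n - 3) \<le> (\<Sum>u\<in>W. \<Sum>v\<in>W. two u v)"
        using distinct_card[OF vs(1)] vs(2) cardW sW(1) n9 by simp
      have "nonS s u = 1" if "u \<in> set B1" for u
        using step(1)[OF that] dis' that w_sym[of s u] by (auto simp: nonS_def)
      then have "int n - 3 = (\<Sum>u\<in>set B1. nonS s u)" using cB1 by simp
      also have "\<dots> \<le> (\<Sum>u\<in>W. nonS s u)" using B1W fW nonneg by (intro sum_mono2) auto
      finally have "int n - 3 \<le> (\<Sum>u\<in>W. nonS s u)" .
      moreover have "2 * (\<Sum>u\<in>{s}. \<Sum>v\<in>W. nonS u v) \<le> (\<Sum>u\<in>W. \<Sum>v\<in>W. nonS u v) + 1 * (int (card {s}) * (int (card {s}) - 1))"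
        using fW sW nonS_sym upper nonneg by (intro double_sum_incidence) auto
      ultimately have "2 * (int n - 3) \<le> (\<Sum>u\<in>W. \<Sum>v\<in>W. nonS u v)" by simp
      then have "(int c - 1) * (2 * (int n - 3)) \<le> (int c - 1) * (\<Sum>u\<in>W. \<Sum>v\<in>W. nonS u v)"
        "(int c - 2) * (2 * (int n - 3)) \<le> (int c - 2) * (\<Sum>u\<in>W. \<Sum>v\<in>W. two u v)"
        using tw c3 by (auto intro!: mult_left_mono)
      moreover have "0 \<le> (\<Sum>u\<in>W. \<Sum>v\<in>W. zer u v)" by (intro sum_nonneg nonneg)
      ultimately have "(2 * int c - 3) * (2 * (int n - 3)) \<le> Lx"
        using double_sum_loss_ge[of W] unfolding Lx_def by (simp add: algebra_simps)
      moreover have "0 < (int c - 2) * (int n - 4)" using c3 n9 by auto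
      ultimately show False using Lx d by (simp add: algebra_simps)
    next
      case False
      then have "\<And>u. u \<in> set B1 \<Longrightarrow> loss s u = int c" using dis' w_sym[of s] by (auto simp: loss_def)
      then have "int c * (int n - 3) = (\<Sum>u\<in>set B1. loss s u)" using cB1 by simp
      also have "\<dots> \<le> (\<Sum>u\<in>W. loss s u)" using B1W fW nonneg by (intro sum_mono2) auto
      finally have "int c * (int n - 3) \<le> (\<Sum>u\<in>W. loss s u)" .
      moreover have "2 * (\<Sum>u\<in>{s}. \<Sum>v\<in>W. loss u v) \<le> (\<Sum>u\<in>W. \<Sum>v\<in>W. loss u v) + int c * (int (card {s}) * (int (card {s}) - 1))"
        using fW sW loss_sym upper nonneg by (intro double_sum_incidence) auto
      ultimately have "2 * (int c * (int n - 3)) \<le> Lx" by (simp add: Lx_def)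
      then show False using Lx d cn c3 by (simp add: algebra_simps)
    qed
  qed
qed

end

section \<open>Covers by three paths\<close>

lemma double_sum_six:
  fixes f :: "'a \<Rightarrow> 'a \<Rightarrow> int"
  assumes "\<And>u v. f u v = f v u" "\<And>u. f u u = 0" "distinct [p,q,r,s,t,u]"
  shows "(\<Sum>x\<in>{p,q,r,s,t,u}. \<Sum>y\<in>{p,q,r,s,t,u}. f x y) =
    2 * (f p q + f r s + f t u) + 2 * (f p r + f p s + f q r + f q s + f p t + f p u + f q t + f q u
       + f r t + f r u + f s t + f s u)"
  using assms(3) by (simp add: assms(1)[of q p] assms(1)[of r p] assms(1)[of s p] assms(1)[of t p] assms(1)[of u p]
     assms(1)[of r q] assms(1)[of s q] assms(1)[of t q] assms(1)[of u q]
     assms(1)[of s r] assms(1)[of t r] assms(1)[of u r] assms(1)[of t s] assms(1)[of u s] assms(1)[of u t] assms(2))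

lemma double_sum_Un:
  fixes f :: "'a \<Rightarrow> 'a \<Rightarrow> int"
  assumes "\<And>u v. f u v = f v u" "finite A" "finite B" "A \<inter> B = {}"
  shows "(\<Sum>u\<in>A\<union>B. \<Sum>v\<in>A\<union>B. f u v) =
    (\<Sum>u\<in>A. \<Sum>v\<in>A. f u v) + (\<Sum>u\<in>B. \<Sum>v\<in>B. f u v) + 2 * (\<Sum>u\<in>A. \<Sum>v\<in>B. f u v)"
proof -
  have "(\<Sum>u\<in>B. \<Sum>v\<in>A. f u v) = (\<Sum>u\<in>A. \<Sum>v\<in>B. f u v)"
    using assms(1) by (subst sum.swap) simp
  then show ?thesis using assms by (simp add: sum.union_disjoint sum.distrib)
qed

lemma double_sum_nonpos:
  fixes f :: "'a \<Rightarrow> 'b \<Rightarrow> int"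
  assumes "finite A" "finite B" "\<And>u v. 0 \<le> f u v" "(\<Sum>u\<in>A. \<Sum>v\<in>B. f u v) \<le> 0" "u \<in> A" "v \<in> B"
  shows "f u v = 0"
proof -
  have "f u v \<le> (\<Sum>v\<in>B. f u v)" using assms by (intro member_le_sum) auto
  also have "\<dots> \<le> (\<Sum>u\<in>A. \<Sum>v\<in>B. f u v)"
    using assms by (intro member_le_sum[of u A "\<lambda>u. \<Sum>v\<in>B. f u v"]) (auto intro: sum_nonneg)
  finally show ?thesis using assms by (simp add: order_antisym)
qed

text \<open>The variables mark the empty pairs among the twelve pairs of ends of different paths;
  each of three rich paths contributes two of the six clauses. Seven empty pairs add 14 to the
  ordered count \<open>zer_total\<close>, which is at most 12.\<close>

lemma seven_zeros:
  fixes aa ab ba bb ca cb da db ea eb fa fb :: int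
  assumes "0 \<le> aa" "0 \<le> ab" "0 \<le> ba" "0 \<le> bb" "0 \<le> ca" "0 \<le> cb" "0 \<le> da" "0 \<le> db"
      "0 \<le> ea" "0 \<le> eb" "0 \<le> fa" "0 \<le> fb"
    and "aa = 1 \<and> ba = 1 \<or> fa = 1 \<and> fb = 1" "ab = 1 \<and> bb = 1 \<or> ea = 1 \<and> eb = 1"
    and "aa = 1 \<and> ab = 1 \<or> da = 1 \<and> db = 1" "ba = 1 \<and> bb = 1 \<or> ca = 1 \<and> cb = 1"
    and "ca = 1 \<and> da = 1 \<or> eb = 1 \<and> fb = 1" "cb = 1 \<and> db = 1 \<or> ea = 1 \<and> fa = 1"
  shows "7 \<le> aa + ab + ba + bb + (ca + cb + da + db) + (ea + eb + fa + fb)"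
  using assms(13-18) by (elim disjE conjE; use assms(1-12) in linarith)

lemma hd_or_rev: "x \<in> {hd A, last A} \<Longrightarrow> \<exists>B. (B = A \<or> B = rev A) \<and> hd B = x"
  by (metis hd_rev insertE singletonD)

lemma last_or_rev: "x \<in> {hd A, last A} \<Longrightarrow> \<exists>B. (B = A \<or> B = rev A) \<and> last B = x"
  by (metis last_rev insertE singletonD)

locale cover3 = stuck_wgraph +
  assumes no_cov1: "\<not> cov 1 vs"
begin

definition tri :: "'a list \<Rightarrow> 'a list \<Rightarrow> 'a list \<Rightarrow> bool" where
  "tri A B C \<longleftrightarrow> A \<noteq> [] \<and> B \<noteq> [] \<and> C \<noteq> [] \<and> distinct (A @ B @ C) \<and> set (A @ B @ C) = V
     \<and> successively S A \<and> successively S B \<and> successively S C"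

abbreviation rich :: "'a list \<Rightarrow> bool" where
  "rich B \<equiv> \<not> successively (\<lambda>u v. w u v \<le> 2) B"

definition zer_total :: int where "zer_total = (\<Sum>u\<in>V. \<Sum>v\<in>V. zer u v)"
definition two_total :: int where "two_total = (\<Sum>u\<in>V. \<Sum>v\<in>V. two u v)"
definition two_loss :: int where "two_loss = (int c - 2) * two_total"
definition nonS_total :: int where "nonS_total = (\<Sum>u\<in>V. \<Sum>v\<in>V. nonS u v)"

lemma totals_nonneg: "0 \<le> zer_total" "0 \<le> two_total" "0 \<le> nonS_total"
  unfolding zer_total_def two_total_def nonS_total_def by (intro sum_nonneg nonneg)+

lemma totals_bound: "(int c - 1) * nonS_total + zer_total + two_loss \<le> 2 * (int c * (2 * int n - 3) - int n)"
  using nonS_bound by (simp add: zer_total_def two_total_def two_loss_def nonS_total_def)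

lemma two_loss_ge: "two_total \<le> two_loss" "0 \<le> two_loss"
proof -
  have "1 * two_total \<le> (int c - 2) * two_total" using c3 totals_nonneg by (intro mult_right_mono) auto
  then show "two_total \<le> two_loss" by (simp add: two_loss_def)
  then show "0 \<le> two_loss" using totals_nonneg by linarith
qed

section \<open>Symmetries of three-path covers and the joins they forbid\<close>

lemma tri_swap1: "tri A B C \<Longrightarrow> tri B A C"
  and tri_swap2: "tri A B C \<Longrightarrow> tri A C B"
  and tri_rev1: "tri A B C \<Longrightarrow> tri (rev A) B C"
  and tri_rev2: "tri A B C \<Longrightarrow> tri A (rev B) C"
  and tri_rev3: "tri A B C \<Longrightarrow> tri A B (rev C)"
  unfolding tri_def by auto

lemma tri_rot: "tri A B C \<Longrightarrow> tri B C A"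
  unfolding tri_def by auto

lemma tri_endp:
  assumes "tri A B C" shows "endp 2 (hd A) (last C)"
proof -
  let ?vs = "map Some A @ None # map Some B @ None # map Some C"
  have "mset (A @ B @ C) = mset_set V"
    using assms mset_set_set unfolding tri_def by metis
  then have "image_mset Some (mset (A @ B @ C)) = image_mset Some (mset_set V)" by simp
  then have "mset ?vs = image_mset Some (mset_set V) + replicate_mset 2 None"
    by (simp add: numeral_2_eq_2)
  moreover have "successively adj ?vs"
    using assms unfolding tri_def by (auto simp: successively_append_iff successively_Cons)
  ultimately have "cov 2 ?vs" by (simp add: cov_def)
  then show ?thesis using assms unfolding endp_def tri_def by (auto simp: hd_map last_map intro!: exI[of _ ?vs])
qed

text \<open>With \<open>C\<close> moved to the middle and \<open>B\<close> reversed,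
  \<open>hd A\<close> and \<open>hd B\<close> become the outer ends of a cover, and the bounds for
  opposite ends apply.\<close>

lemma tri_ends0:
  assumes "tri A B C" shows "\<not> S (hd A) (hd B)" "deg (hd A) + deg (hd B) + 3 \<le> n"
proof -
  have B: "B \<noteq> []" using assms by (simp add: tri_def)
  have "endp 2 (hd A) (last (rev B))" by (rule tri_endp[OF tri_swap2[OF tri_rev2[OF assms]]])
  then have e: "endp (Suc 1) (hd A) (hd B)" using B by (simp add: last_rev numeral_2_eq_2)
  show "\<not> S (hd A) (hd B)" using endp_nonadj[OF _ e] no_cov1 by blast
  show "deg (hd A) + deg (hd B) + 3 \<le> n"
    using endp_deg_sum[OF _ e] no_cov1 n9 cardV by auto
qed

lemma tri_ends:
  assumes "tri A B C" "x \<in> {hd A, last A}" "y \<in> {hd B, last B}"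
  shows "\<not> S x y" "deg x + deg y + 3 \<le> n"
proof -
  obtain A' where A': "A' = A \<or> A' = rev A" "hd A' = x" using hd_or_rev[OF assms(2)] by blast
  obtain B' where B': "B' = B \<or> B' = rev B" "hd B' = y" using hd_or_rev[OF assms(3)] by blast
  have "tri A' B' C" using A' B' assms(1) tri_rev1 tri_rev2 by blast
  then show "\<not> S x y" "deg x + deg y + 3 \<le> n" using tri_ends0 A' B' by blast+
qed

lemma tri_good:
  assumes "tri A B C" "rich B" "w (last A) (hd B) \<noteq> 0" shows "w (last B) (hd C) = 0"
  using assms stuck2[of A B C] unfolding tri_def by blast

lemma tri_clause0:
  assumes "tri A B C" "rich B" "x \<in> {hd A, last A}" "z \<in> {hd C, last C}"
  shows "w x (hd B) = 0 \<or> w z (last B) = 0"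
proof -
  obtain A' where A': "A' = A \<or> A' = rev A" "last A' = x" using last_or_rev[OF assms(3)] by blast
  obtain C' where C': "C' = C \<or> C' = rev C" "hd C' = z" using hd_or_rev[OF assms(4)] by blast
  have "tri A' B C'" using A' C' assms(1) tri_rev1 tri_rev3 by blast
  from tri_good[OF this assms(2)] show ?thesis
    using A'(2) C'(2) w_sym[of z "last B"] by (cases "w x (hd B) = 0") auto
qed

text \<open>Two joins are forbidden together for every choice of an end of \<open>A\<close> and an
  end of \<open>C\<close>. Hence, for each orientation of \<open>B\<close>, both ends of one of
  these paths are empty to the end of \<open>B\<close> that faces it.\<close>

lemma tri_clause:
  assumes "tri A B C" "rich B"
  shows "w (hd A) (hd B) = 0 \<and> w (last A) (hd B) = 0 \<or> w (hd C) (last B) = 0 \<and> w (last C) (last B) = 0"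
    "w (hd A) (last B) = 0 \<and> w (last A) (last B) = 0 \<or> w (hd C) (hd B) = 0 \<and> w (last C) (hd B) = 0"
proof -
  note 1 = tri_clause0[OF assms]
  show "w (hd A) (hd B) = 0 \<and> w (last A) (hd B) = 0 \<or> w (hd C) (last B) = 0 \<and> w (last C) (last B) = 0"
    using 1[of "hd A" "hd C"] 1[of "hd A" "last C"] 1[of "last A" "hd C"] 1[of "last A" "last C"] by simp argo
  note 2 = tri_clause0[OF tri_swap1[OF tri_rot[OF assms(1)]] assms(2)]
  show "w (hd A) (last B) = 0 \<and> w (last A) (last B) = 0 \<or> w (hd C) (hd B) = 0 \<and> w (last C) (hd B) = 0"
    using 2[of "hd C" "hd A"] 2[of "hd C" "last A"] 2[of "last C" "hd A"] 2[of "last C" "last A"] by simp argo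
qed

text \<open>\<open>(c - 1) * (6 * n - 18)\<close> exceeds the allowance by
  \<open>2 * (c - 2) * (n - 6) - 6\<close>, which is not negative. So no pair is empty and none has
  exactly two colours: \<open>B\<close> is rich, and both joins can be made.\<close>

lemma tri_nonS_total_small:
  assumes t: "tri A B C" and B: "2 \<le> length B" and q: "6 * int n - 18 \<le> nonS_total"
  shows False
proof -
  have "(int c - 1) * (6 * int n - 18) \<le> (int c - 1) * nonS_total" using q c3 by (intro mult_left_mono) auto
  moreover have "1 * 3 \<le> (int c - 2) * (int n - 6)" using c3 n9 by (intro mult_mono) auto
  ultimately have b: "zer_total + two_loss \<le> 0" using totals_bound by (simp add: algebra_simps)
  have z: "zer_total \<le> 0" "two_total \<le> 0" using b totals_nonneg two_loss_ge by auto
  have zer0: "zer u v = 0" if "u \<in> V" "v \<in> V" for u v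
    using double_sum_nonpos[of V V zer] z(1) finV nonneg that unfolding zer_total_def by blast
  have two0: "two u v = 0" if "u \<in> V" "v \<in> V" for u v
    using double_sum_nonpos[of V V two] z(2) finV nonneg that unfolding two_total_def by blast
  obtain b b' r where bs: "B = b # b' # r" using B by (cases B; cases "tl B") auto
  have V: "hd A \<in> V" "last A \<in> V" "hd B \<in> V" "last B \<in> V" "hd C \<in> V" "b \<in> V" "b' \<in> V"
    and ne: "last A \<noteq> hd B" "last B \<noteq> hd C"
    using t hd_in_set[of A] last_in_set[of A] hd_in_set[of B] last_in_set[of B] hd_in_set[of C] bs
    unfolding tri_def by auto
  have "w b b' \<noteq> 2" using two0[of b b'] V by (auto simp: two_def)
  moreover have "2 \<le> w b b'" using t bs by (simp add: tri_def)
  ultimately have "rich B" using bs by auto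
  moreover have "w (last A) (hd B) \<noteq> 0" using zer0[of "last A" "hd B"] V ne by (auto simp: zer_def)
  ultimately have "w (last B) (hd C) = 0" using tri_good[OF t] by blast
  then show False using zer0[of "last B" "hd C"] V ne by (auto simp: zer_def)
qed

section \<open>Three paths with at least two vertices each\<close>

lemma tri_distinct_ends:
  assumes "tri A B C" "2 \<le> length A" "2 \<le> length B" "2 \<le> length C"
  shows "distinct [hd A, last A, hd B, last B, hd C, last C]"
    "{hd A, last A, hd B, last B, hd C, last C} \<subseteq> V"
proof -
  have *: "hd xs \<noteq> last xs" if "distinct xs" "2 \<le> length xs" for xs :: "'a list"
    using that by (cases xs) (auto simp: last_in_set split: if_splits)
  have m: "hd A \<in> set A" "last A \<in> set A" "hd B \<in> set B" "last B \<in> set B" "hd C \<in> set C" "last C \<in> set C"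
    using assms by (auto simp: tri_def)
  have d: "x \<noteq> y" if "set X \<inter> set Y = {}" "x \<in> set X" "y \<in> set Y" for X Y :: "'a list" and x y
    using that by blast
  show "distinct [hd A, last A, hd B, last B, hd C, last C]"
    using d[of A B, OF _ m(1) m(3)] d[of A B, OF _ m(1) m(4)] d[of A B, OF _ m(2) m(3)] d[of A B, OF _ m(2) m(4)]
      d[of A C, OF _ m(1) m(5)] d[of A C, OF _ m(1) m(6)] d[of A C, OF _ m(2) m(5)] d[of A C, OF _ m(2) m(6)]
      d[of B C, OF _ m(3) m(5)] d[of B C, OF _ m(3) m(6)] d[of B C, OF _ m(4) m(5)] d[of B C, OF _ m(4) m(6)]
      assms *[of A] *[of B] *[of C] unfolding tri_def by (simp add: Int_Un_distrib)
  show "{hd A, last A, hd B, last B, hd C, last C} \<subseteq> V"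
    using m assms unfolding tri_def by auto
qed

definition cross :: "('a \<Rightarrow> 'a \<Rightarrow> int) \<Rightarrow> 'a list \<Rightarrow> 'a list \<Rightarrow> int" where
  "cross f A B = f (hd A) (hd B) + f (hd A) (last B) + f (last A) (hd B) + f (last A) (last B)"

lemma tri_bound:
  assumes t: "tri A B C" "2 \<le> length A" "2 \<le> length B" "2 \<le> length C"
  defines "U \<equiv> {hd A, last A, hd B, last B, hd C, last C}"
  defines "i \<equiv> nonS (hd A) (last A) + nonS (hd B) (last B) + nonS (hd C) (last C)"
  shows "3 * int n + 3 \<le> (\<Sum>u\<in>U. \<Sum>v\<in>V. nonS u v)"
    "(\<Sum>u\<in>U. \<Sum>v\<in>U. nonS u v) \<le> 24 + 2 * i"
    "zer_total + two_loss \<le> 18 - 6 * int c + 2 * (int c - 1) * i - 2 * (int c - 2) * (int n - 9)"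
    "2 * cross zer A B + 2 * cross zer A C + 2 * cross zer B C \<le> zer_total"
proof -
  note d = tri_distinct_ends[OF t]
  have UV: "U \<subseteq> V" using d(2) by (simp add: U_def)
  \<comment> \<open>The six ends are matched across different paths. Each matched pair has degree
    sum at most \<open>n - 3\<close>, and
    \<open>6 * (n - 1) - 3 * (n - 3) = 3 * n + 3\<close>.\<close>
  have "deg (hd A) + deg (hd B) + 3 \<le> n" "deg (last A) + deg (hd C) + 3 \<le> n"
    "deg (last B) + deg (last C) + 3 \<le> n"
    using tri_ends(2)[OF t(1)] tri_ends(2)[OF tri_swap2[OF t(1)]] tri_ends(2)[OF tri_rot[OF t(1)]] by auto
  then have le: "int (deg (hd A) + deg (last A) + deg (hd B) + deg (last B) + deg (hd C) + deg (last C))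
     \<le> 3 * int n - 9" by linarith
  have "(\<Sum>u\<in>U. \<Sum>v\<in>V. nonS u v) = (\<Sum>u\<in>U. int n - 1 - int (deg u))"
    using UV sum_nonS by (intro sum.cong) auto
  also have "\<dots> = 6 * int n - 6 - int (deg (hd A) + deg (last A)
      + deg (hd B) + deg (last B) + deg (hd C) + deg (last C))"
    unfolding U_def using d(1) by simp
  finally have e: "(\<Sum>u\<in>U. \<Sum>v\<in>V. nonS u v) = 6 * int n - 6 - int (deg (hd A) + deg (last A)
      + deg (hd B) + deg (last B) + deg (hd C) + deg (last C))" .
  show 1: "3 * int n + 3 \<le> (\<Sum>u\<in>U. \<Sum>v\<in>V. nonS u v)" unfolding e using le by linarith
  have six: "(\<Sum>u\<in>U. \<Sum>v\<in>U. f u v) = 2 * (f (hd A) (last A) + f (hd B) (last B) + f (hd C) (last C))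
      + 2 * (cross f A B + cross f A C + cross f B C)"
    if "\<And>u v. f u v = f v u" "\<And>u. f u u = 0" for f :: "'a \<Rightarrow> 'a \<Rightarrow> int"
    unfolding U_def using double_sum_six[of f, OF that d(1)] by (simp add: cross_def)
  have cr: "cross nonS X Y \<le> 4" for X Y
    using upper(2) unfolding cross_def by (smt (verit))
  show 2: "(\<Sum>u\<in>U. \<Sum>v\<in>U. nonS u v) \<le> 24 + 2 * i"
    using six[of nonS] nonS_sym cr[of A B] cr[of A C] cr[of B C] unfolding i_def by simp
  have "nonS_total = 2 * (\<Sum>u\<in>U. \<Sum>v\<in>V. nonS u v) - (\<Sum>u\<in>U. \<Sum>v\<in>U. nonS u v)
      + (\<Sum>u\<in>V-U. \<Sum>v\<in>V-U. nonS u v)"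
    unfolding nonS_total_def by (rule double_sum_split[OF finV UV nonS_sym])
  moreover have "0 \<le> (\<Sum>u\<in>V-U. \<Sum>v\<in>V-U. nonS u v)" by (intro sum_nonneg nonneg)
  ultimately have "6 * int n - 18 - 2 * i \<le> nonS_total" using 1 2 by linarith
  then have "(int c - 1) * (6 * int n - 18 - 2 * i) \<le> (int c - 1) * nonS_total" using c3 by (intro mult_left_mono) auto
  then show "zer_total + two_loss \<le> 18 - 6 * int c + 2 * (int c - 1) * i - 2 * (int c - 2) * (int n - 9)"
    using totals_bound by (simp add: algebra_simps)
  have "(\<Sum>u\<in>U. \<Sum>v\<in>U. zer u v) \<le> zer_total"
    unfolding zer_total_def using finV UV nonneg by (intro double_sum_mono_set) auto
  then show "2 * cross zer A B + 2 * cross zer A C + 2 * cross zer B C \<le> zer_total"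
    using six[of zer] zer_sym nonneg(3)[of "hd A" "last A"] nonneg(3)[of "hd B" "last B"] nonneg(3)[of "hd C" "last C"]
    by simp
qed

text \<open>If no path has a strong pair of ends, the bound is
  \<open>12 - 2 * (c - 2) * (n - 9)\<close>. One strong pair of ends, as in a path with two
  vertices, lowers the constant 12 to \<open>14 - 2 * c\<close>, at most 8.\<close>

lemma tri_bound_const:
  assumes t: "tri A B C" "2 \<le> length A" "2 \<le> length B" "2 \<le> length C"
  shows "zer_total + two_loss \<le> 12"
    "nonS (hd A) (last A) + nonS (hd B) (last B) + nonS (hd C) (last C) \<le> 2 \<Longrightarrow> zer_total + two_loss \<le> 8"
    "zer_total + two_loss = 12 \<Longrightarrow> n = 9"
proof -
  define i where "i = nonS (hd A) (last A) + nonS (hd B) (last B) + nonS (hd C) (last C)"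
  have i3: "i \<le> 3" unfolding i_def using upper(2) by (smt (verit))
  note b = tri_bound(3)[OF t, folded i_def]
  have "2 * (int c - 1) * i \<le> 2 * (int c - 1) * 3" using c3 i3 by (intro mult_left_mono) auto
  moreover have "0 \<le> (int c - 2) * (int n - 9)" using c3 n9 by auto
  ultimately show "zer_total + two_loss \<le> 12" using b by (simp add: algebra_simps)
  show "zer_total + two_loss \<le> 8" if "nonS (hd A) (last A) + nonS (hd B) (last B) + nonS (hd C) (last C) \<le> 2"
  proof -
    have "2 * (int c - 1) * i \<le> 2 * (int c - 1) * 2" using c3 that unfolding i_def by (intro mult_left_mono) auto
    then show ?thesis using b \<open>0 \<le> (int c - 2) * (int n - 9)\<close> c3 by (simp add: algebra_simps)
  qed
  show "n = 9" if "zer_total + two_loss = 12"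
  proof -
    have "1 * (int n - 9) \<le> (int c - 2) * (int n - 9)" using c3 n9 by (intro mult_right_mono) auto
    then show ?thesis using b that \<open>2 * (int c - 1) * i \<le> 2 * (int c - 1) * 3\<close> n9 by (simp add: algebra_simps)
  qed
qed

lemma tri_clause_zer:
  assumes t: "tri A B C" and r: "rich B"
  shows "zer (hd A) (hd B) = 1 \<and> zer (last A) (hd B) = 1 \<or> zer (last B) (hd C) = 1 \<and> zer (last B) (last C) = 1"
    "zer (hd A) (last B) = 1 \<and> zer (last A) (last B) = 1 \<or> zer (hd B) (hd C) = 1 \<and> zer (hd B) (last C) = 1"
proof -
  have d: "set A \<inter> set B = {}" "set B \<inter> set C = {}" and ne: "A \<noteq> []" "B \<noteq> []" "C \<noteq> []"
    using t by (auto simp: tri_def)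
  have zer1: "zer u v = 1" if "w u v = 0" "set X \<inter> set Y = {}" "u \<in> set X" "v \<in> set Y" for u v X Y
    using that by (auto simp: zer_def)
  note z = zer1[OF _ d(1) hd_in_set[OF ne(1)] hd_in_set[OF ne(2)]] zer1[OF _ d(1) hd_in_set[OF ne(1)] last_in_set[OF ne(2)]]
    zer1[OF _ d(1) last_in_set[OF ne(1)] hd_in_set[OF ne(2)]] zer1[OF _ d(1) last_in_set[OF ne(1)] last_in_set[OF ne(2)]]
    zer1[OF _ d(2) hd_in_set[OF ne(2)] hd_in_set[OF ne(3)]] zer1[OF _ d(2) hd_in_set[OF ne(2)] last_in_set[OF ne(3)]]
    zer1[OF _ d(2) last_in_set[OF ne(2)] hd_in_set[OF ne(3)]] zer1[OF _ d(2) last_in_set[OF ne(2)] last_in_set[OF ne(3)]]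
  show "zer (hd A) (hd B) = 1 \<and> zer (last A) (hd B) = 1 \<or> zer (last B) (hd C) = 1 \<and> zer (last B) (last C) = 1"
    using tri_clause(1)[OF t r] z w_sym[of "hd C" "last B"] w_sym[of "last C" "last B"] by (elim disjE conjE) simp_all
  show "zer (hd A) (last B) = 1 \<and> zer (last A) (last B) = 1 \<or> zer (hd B) (hd C) = 1 \<and> zer (hd B) (last C) = 1"
    using tri_clause(2)[OF t r] z w_sym[of "hd C" "hd B"] w_sym[of "last C" "hd B"] by (elim disjE conjE) simp_all
qed

text \<open>Each of the two clauses for \<open>C\<close> asks for two empty pairs, and the clauses
  concern disjoint sets of pairs.\<close>

lemma rich_zeros:
  assumes "tri A B C" "rich C"
  shows "4 \<le> cross zer A B + cross zer A C + cross zer B C"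
proof -
  have nn: "0 \<le> zer u v" for u v by (rule nonneg)
  have four: "4 \<le> aa + ab + ba + bb + (ca + cb + da + db) + (ea + eb + fa + fb)"
    if "0 \<le> aa" "0 \<le> ab" "0 \<le> ba" "0 \<le> bb" "0 \<le> ca" "0 \<le> cb" "0 \<le> da" "0 \<le> db"
      "0 \<le> ea" "0 \<le> eb" "0 \<le> fa" "0 \<le> fb"
      "ca = 1 \<and> da = 1 \<or> eb = 1 \<and> fb = 1" "cb = 1 \<and> db = 1 \<or> ea = 1 \<and> fa = 1"
    for aa ab ba bb ca cb da db ea eb fa fb :: int
    using that(13,14) by (elim disjE conjE; use that(1-12) in linarith)
  note C = tri_clause_zer[OF tri_swap2[OF assms(1)] assms(2)]
  show ?thesis unfolding cross_def
    using C by (intro four nn) (simp_all add: zer_sym)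
qed

lemma tri_long_all_rich:
  assumes t: "tri A B C" "2 \<le> length A" "2 \<le> length B" "2 \<le> length C"
    and r: "rich A" "rich B" "rich C"
  shows False
proof -
  have nn: "0 \<le> zer u v" for u v by (rule nonneg)
  note B = tri_clause_zer[OF t(1) r(2)]
  note A = tri_clause_zer[OF tri_swap1[OF t(1)] r(1)]
  note C = tri_clause_zer[OF tri_swap2[OF t(1)] r(3)]
  have "7 \<le> cross zer A B + cross zer A C + cross zer B C"
    unfolding cross_def using A B C by (intro seven_zeros nn) (simp_all add: zer_sym)
  then show False using tri_bound(4)[OF t] tri_bound_const(1)[OF t] two_loss_ge by linarith
qed


lemma two_block:
  assumes "\<not> rich xs" "successively S xs" "distinct xs" "xs \<noteq> []"
  shows "2 * int (length xs) - 2 \<le> (\<Sum>u\<in>set xs. \<Sum>v\<in>set xs. two u v)"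
proof -
  have "successively (\<lambda>u v. 1 \<le> two u v) xs"
    using assms(1,2) by (auto simp: successively_conv_nth two_def intro!: le_antisym)
  then have "2 * (int (length xs) - 1) \<le> (\<Sum>u\<in>set xs. \<Sum>v\<in>set xs. two u v)"
    using assms two_sym nonneg by (intro double_sum_path) auto
  then show ?thesis by simp
qed

lemma tri_blocks:
  assumes t: "tri A B C"
  shows "(\<Sum>u\<in>set A. \<Sum>v\<in>set A. two u v) + (\<Sum>u\<in>set B. \<Sum>v\<in>set B. two u v)
     + (\<Sum>u\<in>set C. \<Sum>v\<in>set C. two u v) + 2 * (\<Sum>u\<in>set A. \<Sum>v\<in>set B. two u v)
     + 2 * (\<Sum>u\<in>set A. \<Sum>v\<in>set C. two u v) + 2 * (\<Sum>u\<in>set B. \<Sum>v\<in>set C. two u v) = two_total"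
proof -
  have d: "set A \<inter> (set B \<union> set C) = {}" "set B \<inter> set C = {}" "V = set A \<union> (set B \<union> set C)"
    using t by (auto simp: tri_def)
  have "(\<Sum>u\<in>set A. \<Sum>v\<in>set B \<union> set C. two u v)
      = (\<Sum>u\<in>set A. \<Sum>v\<in>set B. two u v) + (\<Sum>u\<in>set A. \<Sum>v\<in>set C. two u v)"
    using d(2) by (simp add: sum.union_disjoint sum.distrib)
  moreover have "two_total = (\<Sum>u\<in>set A \<union> (set B \<union> set C). \<Sum>v\<in>set A \<union> (set B \<union> set C). two u v)"
    unfolding two_total_def using d(3) by (simp only:)
  ultimately show ?thesis
    using double_sum_Un[of two "set A" "set B \<union> set C", OF two_sym _ _ d(1)]
      double_sum_Un[of two "set B" "set C", OF two_sym _ _ d(2)] by simp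
qed

lemma length_2_strong: "length xs = 2 \<Longrightarrow> successively S xs \<Longrightarrow> nonS (hd xs) (last xs) = 0"
  by (auto simp: length_Suc_conv numeral_2_eq_2 nonS_def)

text \<open>If the bounds are tight, all three paths have three vertices and every end is joined to every
  middle vertex by at least three colours, except possibly along the paths themselves. Exchanging the
  middle vertices therefore yields three rich paths.\<close>

lemma tri_equality:
  assumes t: "tri A B C" "2 \<le> length A" "2 \<le> length B" "2 \<le> length C"
    and eq: "12 \<le> zer_total + (\<Sum>u\<in>set A. \<Sum>v\<in>set A. two u v) + (\<Sum>u\<in>set B. \<Sum>v\<in>set B. two u v)
       + (\<Sum>u\<in>set C. \<Sum>v\<in>set C. two u v)"
    and P2pos: "two_total \<noteq> 0"
  shows False
proof -
  define i where "i = nonS (hd A) (last A) + nonS (hd B) (last B) + nonS (hd C) (last C)"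
  have blocks: "(\<Sum>u\<in>X. \<Sum>v\<in>Y. two u v) \<ge> 0" for X Y by (intro sum_nonneg nonneg)
  note b = tri_bound_const[OF t, folded i_def]
  \<comment> \<open>The lower bound 12 meets the upper bound, so \<open>two\<close> vanishes between
    different paths, and equality of \<open>two_loss\<close> and \<open>two_total\<close> forces
    \<open>c = 3\<close>.\<close>
  have P12: "zer_total + two_total = 12" "two_loss = two_total"
    using b(1) eq two_loss_ge tri_blocks[OF t(1)] blocks[of "set B" "set A"] blocks[of "set C" "set A"] blocks[of "set C" "set B"]
    by auto
  then have c: "c = 3" using P2pos by (auto simp: two_loss_def)
  have n: "n = 9" using b(3) P12 by simp
  have crosstwo: "(\<Sum>u\<in>set A. \<Sum>v\<in>set B. two u v) \<le> 0" "(\<Sum>u\<in>set A. \<Sum>v\<in>set C. two u v) \<le> 0"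
     "(\<Sum>u\<in>set B. \<Sum>v\<in>set C. two u v) \<le> 0"
    using P12 eq tri_blocks[OF t(1)] blocks[of "set B" "set A"] blocks[of "set C" "set A"] blocks[of "set C" "set B"]
    by auto
  have "\<not> i \<le> 2" using b(2) P12 by auto
  then have i3: "nonS (hd A) (last A) = 1" "nonS (hd B) (last B) = 1" "nonS (hd C) (last C) = 1"
    using upper(2)[of "hd A" "last A"] upper(2)[of "hd B" "last B"] upper(2)[of "hd C" "last C"]
    unfolding i_def by linarith+
  have S: "successively S A" "successively S B" "successively S C" "distinct (A @ B @ C)" "set (A @ B @ C) = V"
    using t(1) by (auto simp: tri_def)
  have "length A \<noteq> 2" "length B \<noteq> 2" "length C \<noteq> 2" using length_2_strong i3 S by fastforce+
  moreover have "length (A @ B @ C) = 9" using S(4,5) distinct_card cardV n by metis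
  ultimately have "length A = 3" "length B = 3" "length C = 3" using t(2-4) by auto
  then obtain a1 x a2 b1 y b2 c1 z c2 where abc: "A = [a1,x,a2]" "B = [b1,y,b2]" "C = [c1,z,c2]"
    by (auto simp: length_Suc_conv numeral_3_eq_3)
  define U where "U = {a1,a2,b1,b2,c1,c2}"
  have UV: "U \<subseteq> V" using S(5) abc by (auto simp: U_def)
  have "3 * int n + 3 \<le> (\<Sum>u\<in>U. \<Sum>v\<in>V. nonS u v)" "(\<Sum>u\<in>U. \<Sum>v\<in>U. nonS u v) \<le> 30"
    using tri_bound(1,2)[OF t] i3 abc unfolding U_def by auto
  moreover have "nonS_total = 2 * (\<Sum>u\<in>U. \<Sum>v\<in>V. nonS u v) - (\<Sum>u\<in>U. \<Sum>v\<in>U. nonS u v)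
      + (\<Sum>u\<in>V-U. \<Sum>v\<in>V-U. nonS u v)"
    unfolding nonS_total_def by (rule double_sum_split[OF finV UV nonS_sym])
  moreover have "0 \<le> (\<Sum>u\<in>V-U. \<Sum>v\<in>V-U. nonS u v)" by (intro sum_nonneg nonneg)
  moreover have "nonS_total \<le> 30" using totals_bound P12 c n by simp
  \<comment> \<open>The rows of \<open>U\<close> sum to at least \<open>3 * n + 3 = 30\<close>, and
    \<open>nonS_total\<close> is at most 30, as is the part inside \<open>U\<close>. So every pair
    leaving \<open>U\<close> is strong.\<close>
  ultimately have "(\<Sum>u\<in>U. \<Sum>v\<in>V. nonS u v) \<le> (\<Sum>u\<in>U. \<Sum>v\<in>U. nonS u v)" using n by linarith
  moreover have "(\<Sum>u\<in>U. \<Sum>v\<in>V. nonS u v) = (\<Sum>u\<in>U. \<Sum>v\<in>U. nonS u v) + (\<Sum>u\<in>U. \<Sum>v\<in>V-U. nonS u v)"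
  proof -
    have "(\<Sum>v\<in>V. nonS u v) = (\<Sum>v\<in>U. nonS u v) + (\<Sum>v\<in>V-U. nonS u v)" for u
      using sum.subset_diff[OF UV finV, of "nonS u"] by simp
    then show ?thesis by (simp add: sum.distrib)
  qed
  ultimately have le: "(\<Sum>u\<in>U. \<Sum>v\<in>V-U. nonS u v) \<le> 0" by linarith
  have mids: "x \<in> V - U" "y \<in> V - U" "z \<in> V - U" using S(4,5) abc by (auto simp: U_def)
  have strong: "S u m" if "u \<in> U" "m \<in> V - U" for u m
    using double_sum_nonpos[of U "V - U" nonS u m] le that finV UV finite_subset nonneg(2)
    by (fastforce simp: nonS_def)
  have tw: "two u v = 0 \<and> two v u = 0" if "u \<in> set A \<and> v \<in> set B \<or> u \<in> set A \<and> v \<in> set C \<or> u \<in> set B \<and> v \<in> set C" for u v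
    using that double_sum_nonpos[of "set A" "set B" two u v] double_sum_nonpos[of "set A" "set C" two u v]
      double_sum_nonpos[of "set B" "set C" two u v] crosstwo nonneg(4) two_sym[of u v] by auto
  have big: "\<not> w u m \<le> 2" if "u \<in> U" "m \<in> V - U" "two u m = 0" for u m
    using strong[OF that(1,2)] that(3) by (auto simp: two_def)
  have U: "a1 \<in> U" "a2 \<in> U" "b1 \<in> U" "b2 \<in> U" "c1 \<in> U" "c2 \<in> U" by (auto simp: U_def)
  \<comment> \<open>Each middle vertex receives one end of each of the other two paths; by
    \<open>tw\<close> and \<open>big\<close> these pairs carry at least three colours.\<close>
  have "tri [b1,x,c1] [a1,y,c2] [a2,z,b2]"
    using S abc strong mids U w_sym unfolding tri_def by auto
  moreover have "rich [b1,x,c1]" "rich [a1,y,c2]" "rich [a2,z,b2]"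
    using big[OF U(3) mids(1)] big[OF U(1) mids(2)] big[OF U(2) mids(3)]
      tw[of x b1] tw[of a1 y] tw[of a2 z] abc by auto
  ultimately show False by (intro tri_long_all_rich) auto
qed

text \<open>The rich \<open>C\<close> forces four empty pairs, hence 8 in \<open>zer_total\<close>,
  and \<open>A\<close> pays 2 for each of its edges. If \<open>A\<close> has two vertices, only 8 is
  available in all; if it is longer, the sum reaches 12, the tight case.\<close>

lemma tri_long_one_poor:
  assumes t: "tri A B C" "2 \<le> length A" "2 \<le> length B" "2 \<le> length C"
    and r: "\<not> rich A" "rich B" "rich C"
  shows False
proof -
  have "4 \<le> cross zer A B + cross zer A C + cross zer B C" by (rule rich_zeros[OF t(1) r(3)])
  then have zer_total: "8 \<le> zer_total" using tri_bound(4)[OF t] by linarith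
  have S: "successively S A" "distinct A" "A \<noteq> []" using t(1) by (auto simp: tri_def)
  have tA: "2 * int (length A) - 2 \<le> (\<Sum>u\<in>set A. \<Sum>v\<in>set A. two u v)" by (rule two_block[OF r(1) S])
  have nonn: "(\<Sum>u\<in>X. \<Sum>v\<in>Y. two u v) \<ge> 0" for X Y by (intro sum_nonneg nonneg)
  have two_total: "2 * int (length A) - 2 \<le> two_total"
    using tA tri_blocks[OF t(1)] nonn[of "set B" "set B"] nonn[of "set C" "set C"]
      nonn[of "set B" "set A"] nonn[of "set C" "set A"] nonn[of "set C" "set B"] by linarith
  note two_loss = two_loss_ge
  show False
  proof (cases "length A = 2")
    case True
    then have "zer_total + two_loss \<le> 8"
      using tri_bound_const(2)[OF t] length_2_strong[OF True S(1)] upper(2)[of "hd B" "last B"] upper(2)[of "hd C" "last C"]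
      by linarith
    then show False using zer_total two_total two_loss True by simp
  next
    case False
    then have "4 \<le> (\<Sum>u\<in>set A. \<Sum>v\<in>set A. two u v)" "4 \<le> two_total" using tA two_total t(2) by linarith+
    then show False using tri_equality[OF t] zer_total nonn[of "set B" "set B"] nonn[of "set C" "set C"] by linarith
  qed
qed

text \<open>If \<open>C\<close> is rich, its empty pairs and the two poor paths cost more than is
  available. If \<open>C\<close> is poor too, the three paths have \<open>n - 3\<close> edges with
  exactly two colours, at least 6, and this is again the tight case.\<close>

lemma tri_long_two_poor:
  assumes t: "tri A B C" "2 \<le> length A" "2 \<le> length B" "2 \<le> length C"
    and r: "\<not> rich A" "\<not> rich B"
  shows False
proof -
  have S: "successively S A" "distinct A" "A \<noteq> []" "successively S B" "distinct B" "B \<noteq> []"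
    "successively S C" "distinct C" "C \<noteq> []" using t(1) by (auto simp: tri_def)
  have tA: "2 * int (length A) - 2 \<le> (\<Sum>u\<in>set A. \<Sum>v\<in>set A. two u v)" by (rule two_block[OF r(1) S(1-3)])
  have tB: "2 * int (length B) - 2 \<le> (\<Sum>u\<in>set B. \<Sum>v\<in>set B. two u v)" by (rule two_block[OF r(2) S(4-6)])
  have nonn: "(\<Sum>u\<in>X. \<Sum>v\<in>Y. two u v) \<ge> 0" for X Y by (intro sum_nonneg nonneg)
  have bl: "(\<Sum>u\<in>set A. \<Sum>v\<in>set A. two u v) + (\<Sum>u\<in>set B. \<Sum>v\<in>set B. two u v)
     + (\<Sum>u\<in>set C. \<Sum>v\<in>set C. two u v) \<le> two_total"
    using tri_blocks[OF t(1)] nonn[of "set B" "set A"] nonn[of "set C" "set A"] nonn[of "set C" "set B"] by linarith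
  note two_loss = two_loss_ge
  have short: "zer_total + two_total \<le> 8" if "length A = 2 \<or> length B = 2 \<or> length C = 2"
    using that tri_bound_const(2)[OF t] length_2_strong[OF _ S(1)] length_2_strong[OF _ S(4)] length_2_strong[OF _ S(7)]
      upper(2)[of "hd A" "last A"] upper(2)[of "hd B" "last B"] upper(2)[of "hd C" "last C"] two_loss by linarith
  have P12: "zer_total + two_total \<le> 12" using tri_bound_const(1)[OF t] two_loss by linarith
  show False
  proof (cases "rich C")
    case True
    have "4 \<le> cross zer A B + cross zer A C + cross zer B C" by (rule rich_zeros[OF t(1) True])
    then have zer_total: "8 \<le> zer_total" using tri_bound(4)[OF t] by linarith
    then show False
      using short P12 tA tB bl t(2,3) nonn[of "set C" "set C"] by (cases "length A = 2 \<or> length B = 2") auto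
  next
    case False
    have tC: "2 * int (length C) - 2 \<le> (\<Sum>u\<in>set C. \<Sum>v\<in>set C. two u v)" by (rule two_block[OF False S(7-9)])
    have "length (A @ B @ C) = n" using t(1) distinct_card cardV unfolding tri_def by metis
    then have "12 \<le> (\<Sum>u\<in>set A. \<Sum>v\<in>set A. two u v) + (\<Sum>u\<in>set B. \<Sum>v\<in>set B. two u v)
       + (\<Sum>u\<in>set C. \<Sum>v\<in>set C. two u v)" using tA tB tC n9 by simp
    then show False using tri_equality[OF t] totals_nonneg bl by linarith
  qed
qed

lemma tri_not_all_long:
  assumes t: "tri A B C" "2 \<le> length A" "2 \<le> length B" "2 \<le> length C"
  shows False
  using tri_long_all_rich[OF t] tri_long_one_poor[OF t] tri_long_two_poor[OF t]
    tri_long_one_poor[OF tri_swap1[OF t(1)] t(3,2,4)] tri_long_one_poor[OF tri_rot[OF tri_rot[OF t(1)]] t(4,2,3)]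
    tri_long_two_poor[OF tri_swap2[OF t(1)] t(2,4,3)] tri_long_two_poor[OF tri_rot[OF t(1)] t(3,4,2)]
  by (cases "rich A"; cases "rich B"; cases "rich C") simp_all

section \<open>Covers with one-vertex paths\<close>

lemma tri_move:
  assumes "tri [x] (B1 @ v # B2) C" "S x v" "B1 \<noteq> []" "B2 \<noteq> []"
  shows "tri (x # v # B2) B1 C" "tri (x # v # rev B1) B2 C"
  using assms w_sym[of v "last B1"] unfolding tri_def
  by (auto simp: successively_append_iff successively_Cons hd_rev)

lemma tri_interior:
  assumes t: "tri A B C" "x \<in> {hd A, last A}" and v: "S x v" "v \<in> set B"
  obtains B1 B2 where "B = B1 @ v # B2" "B1 \<noteq> []" "B2 \<noteq> []"
proof -
  obtain B1 B2 where B: "B = B1 @ v # B2" using v(2) by (meson split_list)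
  have "v \<noteq> hd B" "v \<noteq> last B" using tri_ends(1)[OF t] v(1) by auto
  then have "B1 \<noteq> []" "B2 \<noteq> []" using B by auto
  then show thesis using that B by blast
qed

text \<open>Otherwise \<open>x\<close> could be attached to \<open>v\<close> and one side of
  \<open>B\<close> split off so that all three paths have at least two vertices. As \<open>v\<close>
  is no end of \<open>B\<close>, exactly one vertex remains on each side.\<close>

lemma tri_single_move:
  assumes t: "tri [x] B C" "2 \<le> length C" and v: "S x v" "v \<in> set B"
  shows "\<exists>b b'. B = [b, v, b']"
proof -
  obtain B1 B2 where B: "B = B1 @ v # B2" "B1 \<noteq> []" "B2 \<noteq> []"
    using tri_interior[OF t(1) _ v] by auto
  note m = tri_move[OF t(1)[unfolded B(1)] v(1) B(2,3)]
  have "\<not> 2 \<le> length B1" using tri_not_all_long[OF m(1)] t(2) by auto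
  moreover have "\<not> 2 \<le> length B2" using tri_not_all_long[OF m(2)] t(2) by auto
  moreover have "length B1 \<noteq> 0" "length B2 \<noteq> 0" using B(2,3) by simp_all
  ultimately have "length B1 = Suc 0" "length B2 = Suc 0" by linarith+
  then obtain b b' where "B1 = [b]" "B2 = [b']" by (auto simp: length_Suc_conv)
  then show ?thesis using B(1) by simp
qed

lemma deg_le_1:
  assumes "\<And>v. v \<in> V \<Longrightarrow> S x v \<Longrightarrow> v = m" shows "deg x \<le> 1"
proof -
  have "{u \<in> V. S x u} \<subseteq> {m}"
  proof
    fix u assume "u \<in> {u \<in> V. S x u}"
    then have "u \<in> V" "S x u" by simp_all
    then have "u = m" by (rule assms)
    then show "u \<in> {m}" by simp
  qed
  then have "card {u \<in> V. S x u} \<le> card {m}" by (intro card_mono) auto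
  then show ?thesis by (simp add: deg_def)
qed

text \<open>\<open>x\<close>, \<open>b\<close> and \<open>b'\<close> can exchange roles around
  \<open>v\<close>. A strong neighbour of any of them in \<open>C\<close> would force
  \<open>C\<close> to have three vertices, so \<open>v\<close> is their only one. The resulting
  bound is \<open>2 * (3 * (n - 1) - 3) - 6 = 6 * n - 18\<close>.\<close>

lemma tri_single_short:
  assumes t: "tri [x] [b, v, b'] C" "2 \<le> length C" and long: "length C \<noteq> 3"
    and v: "S x v"
  shows False
proof -
  have S: "S b v" "S v b'" using t(1) by (auto simp: tri_def)
  have tb: "tri [b] [x, v, b'] C" "tri [b'] [b, v, x] C"
    using t(1) v S w_sym unfolding tri_def by auto
  have nb: "\<not> S x b" "\<not> S x b'" "\<not> S b b'"
    using tri_ends(1)[OF t(1), of x b] tri_ends(1)[OF t(1), of x b'] tri_ends(1)[OF tb(1), of b b'] by auto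
  have nb': "\<not> S y z" if "y \<in> {x, b, b'}" "z \<in> {x, b, b'}" for y z
    using nb w_sym[of b x] w_sym[of b' x] w_sym[of b' b] that by auto
  have Vset: "V = {x, b, v, b'} \<union> set C" using t(1) unfolding tri_def by auto
  have noC: "\<not> S y u" if "y \<in> {x, b, b'}" "u \<in> set C" for y u
  proof
    assume "S y u"
    have "tri [y] [b,v,b'] C \<or> tri [y] [x,v,b'] C \<or> tri [y] [b,v,x] C" using that(1) t(1) tb by auto
    moreover have "length [b,v,b'] = 3" "length [x,v,b'] = 3" "length [b,v,x] = 3" by simp_all
    ultimately obtain B where B: "tri [y] B C" "length B = 3" by metis
    then have "\<exists>p q. C = [p, u, q]"
      using tri_single_move[OF tri_swap2[OF B(1)] _ \<open>S y u\<close> that(2)] by simp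
    then show False using long by auto
  qed
  have "deg y \<le> 1" if y: "y \<in> {x, b, b'}" for y
  proof (rule deg_le_1[of _ v])
    show "u = v" if u: "u \<in> V" "S y u" for u
    proof -
      have "u \<notin> set C" using noC[OF y] u(2) by blast
      moreover have "u \<notin> {x, b, b'}" using nb'[OF y] u(2) by blast
      ultimately show ?thesis using u(1) Vset by blast
    qed
  qed
  then have d: "deg x \<le> 1" "deg b \<le> 1" "deg b' \<le> 1" by auto
  have xb: "{x,b,b'} \<subseteq> V" "x \<noteq> b" "x \<noteq> b'" "b \<noteq> b'" using t(1) by (auto simp: tri_def)
  have "2 * (\<Sum>u\<in>{x,b,b'}. \<Sum>v\<in>V. nonS u v) \<le> nonS_total + 1 * (int (card {x,b,b'}) * (int (card {x,b,b'}) - 1))"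
    unfolding nonS_total_def using xb finV nonS_sym upper nonneg by (intro double_sum_incidence) auto
  moreover have "card {x,b,b'} = 3" using xb by simp
  moreover have "(\<Sum>u\<in>{x,b,b'}. \<Sum>v\<in>V. nonS u v) = 3 * (int n - 1) - int (deg x) - int (deg b) - int (deg b')"
    using xb sum_nonS[of x] sum_nonS[of b] sum_nonS[of b'] by simp
  ultimately have "6 * int n - 18 \<le> nonS_total" using d by simp
  then show False using tri_nonS_total_small[OF t(1)] by simp
qed

lemma tri_not_one_single:
  assumes t: "tri [x] B C" "2 \<le> length B" "2 \<le> length C"
  shows False
proof (cases "\<exists>v\<in>V. S x v")
  case True
  then obtain v where v: "v \<in> V" "S x v" by blast
  have len: "1 + length B + length C = n"
    using t(1) distinct_card[of "[x] @ B @ C"] cardV unfolding tri_def by simp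
  have "v \<noteq> x" using v by auto
  then consider "v \<in> set B" | "v \<in> set C" using v t(1) by (auto simp: tri_def)
  then show False
  proof cases
    case 1
    then obtain b b' where B: "B = [b, v, b']" using tri_single_move[OF t(1,3) v(2)] by blast
    \<comment> \<open>If \<open>C\<close> had three vertices as well, \<open>n\<close> would be
      7.\<close>
    then show False using tri_single_short[OF t(1)[unfolded B] t(3) _ v(2)] len n9 by auto
  next
    case 2
    then obtain b b' where C: "C = [b, v, b']" using tri_single_move[OF tri_swap2[OF t(1)] t(2) v(2)] by blast
    then show False using tri_single_short[OF tri_swap2[OF t(1), unfolded C] t(2) _ v(2)] len n9 by auto
  qed
next
  case False
  then have "{u \<in> V. S x u} = {}" by auto
  then have d0: "deg x = 0" by (metis card.empty deg_def)
  have tB: "B \<noteq> []" "C \<noteq> []" using t by auto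
  have *: "hd xs \<noteq> last xs" if "distinct xs" "2 \<le> length xs" for xs :: "'a list"
    using that by (cases xs) (auto simp: last_in_set split: if_splits)
  have m: "hd B \<in> set B" "last B \<in> set B" "hd C \<in> set C" "last C \<in> set C" using tB by auto
  \<comment> \<open>The row of \<open>x\<close> is full, and the other four ends are matched across
    \<open>B\<close> and \<open>C\<close>, which gives
    \<open>2 * (5 * (n - 1) - 2 * (n - 3)) - 20 = 6 * n - 18\<close>.\<close>
  define U where "U = {x, hd B, last B, hd C, last C}"
  have dist: "distinct [x, hd B, last B, hd C, last C]"
  proof -
    have "set B \<inter> set C = {}" "x \<notin> set B" "x \<notin> set C" "distinct B" "distinct C"
      using t(1) by (auto simp: tri_def)
    then show ?thesis using m *[of B] *[of C] t(2,3) by (auto dest!: disjoint_iff[THEN iffD1])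
  qed
  have UV: "U \<subseteq> V" using m t(1) by (auto simp: U_def tri_def)
  have "deg (hd B) + deg (hd C) + 3 \<le> n" "deg (last B) + deg (last C) + 3 \<le> n"
    using tri_ends(2)[OF tri_rot[OF t(1)]] by auto
  moreover have "(\<Sum>u\<in>U. \<Sum>v\<in>V. nonS u v) = 5 * (int n - 1) - int (deg (hd B)) - int (deg (last B))
      - int (deg (hd C)) - int (deg (last C))"
  proof -
    have "(\<Sum>u\<in>U. \<Sum>v\<in>V. nonS u v) = (\<Sum>u\<in>U. int n - 1 - int (deg u))"
      using UV sum_nonS by (intro sum.cong) auto
    also have "\<dots> = 5 * (int n - 1) - int (deg (hd B)) - int (deg (last B)) - int (deg (hd C)) - int (deg (last C))"
      unfolding U_def using dist d0 by simp
    finally show ?thesis .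
  qed
  moreover have "2 * (\<Sum>u\<in>U. \<Sum>v\<in>V. nonS u v) \<le> nonS_total + 1 * (int (card U) * (int (card U) - 1))"
    unfolding nonS_total_def using UV finV nonS_sym upper nonneg by (intro double_sum_incidence) auto
  moreover have "card U = 5" unfolding U_def using dist by simp
  ultimately have "6 * int n - 18 \<le> nonS_total" by simp
  then show False using tri_nonS_total_small[OF t(1,2)] by simp
qed

text \<open>Attaching \<open>x\<close> to an inner vertex of \<open>C\<close> leaves
  \<open>y\<close> as the only one-vertex path if the part split off has two vertices. One of the
  two possible parts does, since \<open>C\<close> has at least seven.\<close>

lemma tri_two_singles_isolated:
  assumes t: "tri [x] [y] C" and v: "v \<in> V" "S x v"
  shows False
proof -
  have len: "2 + length C = n"
    using t distinct_card[of "[x] @ [y] @ C"] cardV unfolding tri_def by simp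
  have "v \<noteq> x" using v by auto
  moreover have "v \<noteq> y" using tri_ends(1)[OF t, of x y] v by auto
  ultimately have vC: "v \<in> set C" using t v by (auto simp: tri_def)
  have t': "tri [x] C [y]" by (rule tri_swap2[OF t])
  obtain C1 C2 where C: "C = C1 @ v # C2" "C1 \<noteq> []" "C2 \<noteq> []"
    using tri_interior[OF t' _ v(2) vC] by auto
  note m = tri_move[OF t'[unfolded C(1)] v(2) C(2,3)]
  have "2 \<le> length C1 \<or> 2 \<le> length C2" using len n9 C(1) by auto
  then show False
    using tri_not_one_single[OF tri_rot[OF tri_rot[OF m(1)]]] tri_not_one_single[OF tri_rot[OF tri_rot[OF m(2)]]] by auto
qed


text \<open>Here \<open>2 * n - 6\<close> of the allowance remains. A spanning strong path of
  \<open>R\<close> without a pair of three colours uses all of it, so \<open>R\<close> is complete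
  in strong pairs and another path can be chosen. If every such path is rich, its ends
  \<open>u\<close>, \<open>v\<close> make the pair of \<open>x\<close> and \<open>u\<close> or that
  of \<open>y\<close> and \<open>v\<close> empty, and rotation multiplies these empty pairs.\<close>

lemma tri_isolated_pair:
  assumes t: "tri [x] [y] C0" and d: "deg x = 0" "deg y = 0"
  shows False
proof -
  define R where "R = V - {x, y}"
  have V: "x \<in> V" "y \<in> V" "x \<noteq> y" using t by (auto simp: tri_def)
  have fR: "finite R" using finV by (simp add: R_def)
  have cardR: "card R = n - 2" using V cardV finV by (simp add: R_def)
  interpret R: sgraph R "\<lambda>u v. 2 \<le> w u v"
    by unfold_locales (use fR w_sym in auto)
  have nS: "\<not> S x v" "\<not> S y v" "\<not> S v x" "\<not> S v y" if "v \<in> V" for v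
    using deg_0D[OF d(1) that] deg_0D[OF d(2) that] w_sym by auto
  have Rdeg: "R.deg u = deg u" if "u \<in> R" for u
  proof -
    have "{v \<in> R. S u v} = {v \<in> V. S u v}" using nS that by (auto simp: R_def)
    then show ?thesis by (simp add: R.deg_def deg_def)
  qed
  have sumV: "(\<Sum>v\<in>V. f v) = f x + f y + (\<Sum>v\<in>R. f v)" for f :: "'a \<Rightarrow> int"
    using V finV sum.subset_diff[of "{x,y}" V f] by (simp add: R_def)
  define QR where "QR = (\<Sum>u\<in>R. \<Sum>v\<in>R. nonS u v)"
  have QR0: "0 \<le> QR" unfolding QR_def by (intro sum_nonneg nonneg)
  have xyV: "{x,y} \<subseteq> V" using V by simp
  have "nonS_total = 2 * (\<Sum>u\<in>{x,y}. \<Sum>v\<in>V. nonS u v) - (\<Sum>u\<in>{x,y}. \<Sum>v\<in>{x,y}. nonS u v) + QR"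
    unfolding nonS_total_def QR_def R_def by (rule double_sum_split[OF finV xyV nonS_sym])
  moreover have "(\<Sum>u\<in>{x,y}. \<Sum>v\<in>V. nonS u v) = 2 * int n - 2"
    using V sum_nonS[of x] sum_nonS[of y] d by simp
  moreover have "(\<Sum>u\<in>{x,y}. \<Sum>v\<in>{x,y}. nonS u v) \<le> 2"
    using V upper(2)[of x y] nonS_sym[of x y] by simp
  ultimately have "4 * int n - 6 + QR \<le> nonS_total" by linarith
  then have "(int c - 1) * (4 * int n - 6 + QR) \<le> (int c - 1) * nonS_total" using c3 by (intro mult_left_mono) auto
  moreover have "2 * QR \<le> (int c - 1) * QR" using c3 QR0 by (intro mult_right_mono) auto
  ultimately have PB: "zer_total + two_loss + 2 * QR \<le> 2 * int n - 6" using totals_bound by (simp add: algebra_simps)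
  have degR: "2 * int n - 6 \<le> 2 * int (deg u) + QR" if u: "u \<in> R" for u
  proof -
    have "2 * (\<Sum>u\<in>{u}. \<Sum>v\<in>R. nonS u v) \<le> QR + 1 * (int (card {u}) * (int (card {u}) - 1))"
      unfolding QR_def using u fR nonS_sym upper nonneg by (intro double_sum_incidence) auto
    moreover have "u \<in> V" "u \<noteq> x" "u \<noteq> y" using u by (auto simp: R_def)
    then have "(\<Sum>v\<in>R. nonS u v) = int n - 3 - int (deg u)"
      using sumV[of "nonS u"] sum_nonS[of u] nS[of u] by (simp add: nonS_def)
    ultimately show ?thesis by simp
  qed
  have zeros: "2 * int (card X) + 2 * int (card Y) \<le> zer_total"
    if "X \<subseteq> R" "Y \<subseteq> R" "\<And>u. u \<in> X \<Longrightarrow> w x u = 0" "\<And>u. u \<in> Y \<Longrightarrow> w y u = 0" for X Y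
  proof -
    have "int (card X) \<le> (\<Sum>v\<in>R. zer x v)" by (rule sum_zer_ge) (use that fR in \<open>auto simp: R_def\<close>)
    moreover have "int (card Y) \<le> (\<Sum>v\<in>R. zer y v)" by (rule sum_zer_ge) (use that fR in \<open>auto simp: R_def\<close>)
    moreover have "zer_total = 2 * (\<Sum>u\<in>{x,y}. \<Sum>v\<in>V. zer u v) - (\<Sum>u\<in>{x,y}. \<Sum>v\<in>{x,y}. zer u v)
        + (\<Sum>u\<in>V-{x,y}. \<Sum>v\<in>V-{x,y}. zer u v)"
      unfolding zer_total_def by (rule double_sum_split[OF finV xyV zer_sym])
    moreover have "0 \<le> (\<Sum>u\<in>V-{x,y}. \<Sum>v\<in>V-{x,y}. zer u v)" by (intro sum_nonneg nonneg)
    moreover have "(\<Sum>u\<in>{x,y}. \<Sum>v\<in>V. zer u v) = 2 * zer x y + (\<Sum>v\<in>R. zer x v) + (\<Sum>v\<in>R. zer y v)"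
      using V sumV[of "zer x"] sumV[of "zer y"] zer_sym[of x y] by simp
    moreover have "(\<Sum>u\<in>{x,y}. \<Sum>v\<in>{x,y}. zer u v) = 2 * zer x y"
      using V zer_sym[of x y] by simp
    ultimately show ?thesis using nonneg(3)[of x y] by linarith
  qed
  have triR: "tri [x] L [y]" if "L \<noteq> []" "distinct L" "set L = R" "successively S L" for L
    using that V by (auto simp: tri_def R_def)
  have C0: "C0 \<noteq> []" "distinct C0" "set C0 = R" "successively S C0" using t by (auto simp: tri_def R_def)
  have RV: "R \<subseteq> V" by (auto simp: R_def)
  show False
  proof (cases "\<exists>L. L \<noteq> [] \<and> distinct L \<and> set L = R \<and> successively S L \<and> \<not> rich L")
    case True
    then obtain L where L: "L \<noteq> []" "distinct L" "set L = R" "successively S L" "\<not> rich L" by blast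
    have "2 * int (length L) - 2 \<le> (\<Sum>u\<in>set L. \<Sum>v\<in>set L. two u v)" by (rule two_block[OF L(5,4,2,1)])
    also have "\<dots> \<le> two_total" unfolding two_total_def L(3) using finV RV nonneg by (intro double_sum_mono_set) auto
    finally have two_total: "2 * int n - 6 \<le> two_total" using distinct_card[OF L(2)] L(3) cardR n9 by simp
    then have z: "zer_total \<le> 0" "QR \<le> 0" "two_total \<le> 2 * int n - 6" using PB two_loss_ge totals_nonneg QR0 by linarith+
    have SR: "S u v" if "u \<in> R" "v \<in> R" "u \<noteq> v" for u v
      using double_sum_nonpos[of R R nonS u v] z(2) fR nonneg(2) that unfolding QR_def by (auto simp: nonS_def)
    have nz: "w u v \<noteq> 0" if "u \<in> V" "v \<in> V" "u \<noteq> v" for u v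
      using double_sum_nonpos[of V V zer u v] z(1) finV nonneg(3) that unfolding zer_total_def by (auto simp: zer_def)
    \<comment> \<open>If all pairs in \<open>R\<close> had exactly two colours,
      \<open>two_total\<close> would be at least \<open>(n - 2) * (n - 3)\<close>. A pair with three
      colours can then start a spanning path, since all pairs in \<open>R\<close> are
      strong.\<close>
    have "\<exists>u\<in>R. \<exists>v\<in>R. 2 < w u v"
    proof (rule ccontr)
      assume "\<not> ?thesis"
      then have all2: "two u v = 1" if "u \<in> R" "v \<in> R" "u \<noteq> v" for u v
        using SR[OF that] that by (force simp: two_def)
      have "(\<Sum>v\<in>R. two u v) = int n - 3" if u: "u \<in> R" for u
      proof -
        have "(\<Sum>v\<in>R. two u v) = (\<Sum>v\<in>R-{u}. two u v)" using sum.remove[OF fR u, of "two u"] by simp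
        also have "\<dots> = (\<Sum>v\<in>R-{u}. 1)" using all2 u by (intro sum.cong) auto
        also have "\<dots> = int n - 3" using u fR cardR n9 by simp
        finally show ?thesis .
      qed
      then have "(\<Sum>u\<in>R. \<Sum>v\<in>R. two u v) = (int n - 2) * (int n - 3)" using cardR n9 by simp
      moreover have "(\<Sum>u\<in>R. \<Sum>v\<in>R. two u v) \<le> two_total"
        unfolding two_total_def using finV RV nonneg by (intro double_sum_mono_set) auto
      moreover have "7 * (int n - 3) \<le> (int n - 2) * (int n - 3)" using n9 by (intro mult_right_mono) auto
      ultimately show False using z(3) n9 by simp
    qed
    then obtain u v where uv: "u \<in> R" "v \<in> R" "2 < w u v" by blast
    then have uv': "u \<noteq> v" by auto
    obtain r where r: "set r = R - {u,v}" "distinct r" using finite_distinct_list fR by (metis finite_Diff)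
    define L' where "L' = u # v # r"
    have L': "L' \<noteq> []" "distinct L'" "set L' = R" using r uv uv' by (auto simp: L'_def)
    have "successively S L'"
    proof (unfold successively_conv_nth, intro allI impI)
      fix i assume i: "Suc i < length L'"
      then have "L' ! i \<noteq> L' ! Suc i" using nth_eq_iff_index_eq[OF L'(2)] by simp
      then show "S (L' ! i) (L' ! Suc i)" using SR L'(3) i by (metis Suc_lessD nth_mem)
    qed
    then have "tri [x] L' [y]" using triR L' by blast
    moreover have "rich L'" using uv by (auto simp: L'_def)
    moreover have "w (last [x]) (hd L') \<noteq> 0" using nz[of x u] V uv by (auto simp: L'_def R_def)
    ultimately have "w (last L') (hd [y]) = 0" by (rule tri_good)
    moreover have "last L' \<in> R" using L' last_in_set by blast
    ultimately show False using nz[of "last L'" y] V by (auto simp: R_def)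
  next
    case False
    \<comment> \<open>\<open>degR\<close> and \<open>PB\<close> together give
      \<open>zer_total \<le> 2 * deg u\<close>. An empty pair counts twice, so
      \<open>deg u + 1\<close> of them are a contradiction.\<close>
    have bad: False if "u \<in> R" "2 * int (deg u) + 2 \<le> zer_total" for u
      using that degR[of u] PB two_loss_ge QR0 by linarith
    have fail: "w x u = 0 \<or> w y v = 0" if uv: "R.endp 0 u v" for u v
    proof -
      obtain L where L: "L \<noteq> []" "distinct L" "set L = R" "successively S L" "hd L = u" "last L = v"
        using uv unfolding R.endp0_iff by blast
      have "rich L" using False L by blast
      then show ?thesis using tri_good[OF triR[OF L(1-4)]] L w_sym[of y v] by fastforce
    qed
    have rot: "\<exists>X\<subseteq>R. u \<in> X \<and> v \<notin> X \<and> v \<in> R \<and> card X = deg u \<and> (\<forall>u'\<in>X. R.endp 0 u' v)"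
      if uv: "R.endp 0 u v" for u v
    proof -
      obtain L where L: "L \<noteq> []" "set L = R" "hd L = u" "last L = v"
        using uv unfolding R.endp0_iff by blast
      then have "u \<in> R" "v \<in> R" by auto
      have "\<exists>X\<subseteq>R. u \<in> X \<and> v \<notin> X \<and> card X = R.deg u + 0 \<and> (\<forall>u'\<in>X. R.endp 0 u' v)"
        by (rule R.rotation[OF _ uv]) (use cardR n9 in auto)
      then show ?thesis using \<open>v \<in> R\<close> Rdeg[OF \<open>u \<in> R\<close>] by simp
    qed
    \<comment> \<open>If \<open>y\<close> sees \<open>v\<close>, then \<open>x\<close> is empty to
      all \<open>deg u\<close> vertices of \<open>X\<close>. One more empty pair is that of
      \<open>x\<close> and \<open>v\<close>, or else \<open>x\<close> sees \<open>v\<close> and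
      \<open>y\<close> is empty to \<open>X\<close> as well.\<close>
    have claim: "w x v = 0 \<and> w y v = 0" if uv: "R.endp 0 u v" for u v
    proof (rule ccontr)
      assume neg: "\<not> ?thesis"
      obtain X where X: "X \<subseteq> R" "u \<in> X" "v \<notin> X" "v \<in> R" "card X = deg u" "\<And>u'. u' \<in> X \<Longrightarrow> R.endp 0 u' v"
        using rot[OF uv] by blast
      have fX: "finite X" using X(1) fR finite_subset by blast
      have X1: "1 \<le> card X" using X(2) fX by (auto simp: Suc_le_eq card_gt_0_iff)
      have f: "w x u' = 0 \<or> w y v = 0" "w x v = 0 \<or> w y u' = 0" if "u' \<in> X" for u'
        using fail[OF X(6)[OF that]] fail[OF R.endp_sym[OF X(6)[OF that]]] by auto
      consider "w x v \<noteq> 0" "w y v \<noteq> 0" | "w x v = 0" "w y v \<noteq> 0" | "w x v \<noteq> 0" "w y v = 0"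
        using neg by (cases "w x v = 0"; cases "w y v = 0") simp_all
      then have "2 * int (card X) + 2 \<le> zer_total"
      proof cases
        case 1
        then show ?thesis using zeros[of X X] f X(1) X1 by fastforce
      next
        case 2
        then have "2 * int (card (insert v X)) + 2 * int (card ({} :: 'a set)) \<le> zer_total"
          using f X(1,4) by (intro zeros) auto
        then show ?thesis using X(3) fX by simp
      next
        case 3
        then have "2 * int (card ({} :: 'a set)) + 2 * int (card (insert v X)) \<le> zer_total"
          using f X(1,4) by (intro zeros) auto
        then show ?thesis using X(3) fX by simp
      qed
      then show False using bad[of u] X(1,2,5) by auto
    qed
    have "R.endp 0 (hd C0) (last C0)" unfolding R.endp0_iff using C0 by blast
    from rot[OF this]
    obtain X where X: "X \<subseteq> R" "hd C0 \<in> X" "card X = deg (hd C0)" "\<And>u. u \<in> X \<Longrightarrow> R.endp 0 u (last C0)"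
      by auto
    have fX: "finite X" using X(1) fR finite_subset by blast
    have X1: "1 \<le> card X" using X(2) fX by (auto simp: Suc_le_eq card_gt_0_iff)
    have "w x u = 0 \<and> w y u = 0" if "u \<in> X" for u using claim[OF R.endp_sym[OF X(4)[OF that]]] .
    then have "2 * int (card X) + 2 * int (card X) \<le> zer_total" using X(1) by (intro zeros) auto
    then show False using bad[of "hd C0"] X X1 by auto
  qed
qed

lemma no_tri: "\<not> tri A B C"
proof
  assume t: "tri A B C"
  have pair: False if t': "tri [x] [y] Z" for x y Z
  proof -
    have t'': "tri [y] [x] Z" by (rule tri_swap1[OF t'])
    have "{u \<in> V. S x u} = {}" "{u \<in> V. S y u} = {}"
      using tri_two_singles_isolated[OF t'] tri_two_singles_isolated[OF t''] by auto
    then have "deg x = 0" "deg y = 0" unfolding deg_def by (simp_all only: card.empty)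
    then show False using tri_isolated_pair[OF t'] by blast
  qed
  have single: False if t': "tri [x] Y Z" for x Y Z
  proof -
    have ne: "Y \<noteq> []" "Z \<noteq> []" using t' by (auto simp: tri_def)
    consider "2 \<le> length Y" "2 \<le> length Z" | y where "Y = [y]" | z where "Z = [z]"
      using ne by (cases Y; cases Z; cases "tl Y"; cases "tl Z") auto
    then show False
    proof cases
      case 1 then show False using tri_not_one_single[OF t'] by blast
    next
      case 2 then show False using pair t' by blast
    next
      case 3 then show False using pair tri_swap2[OF t'] by blast
    qed
  qed
  have ne: "A \<noteq> []" "B \<noteq> []" "C \<noteq> []" using t by (auto simp: tri_def)
  have one: "2 \<le> length X \<or> (\<exists>x. X = [x])" if "X \<noteq> []" for X :: "'a list"
    using that by (cases X; cases "tl X") auto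
  show False
    using one[OF ne(1)] one[OF ne(2)] one[OF ne(3)] tri_not_all_long[OF t] single t tri_swap1[OF t] tri_rot[OF tri_rot[OF t]]
    by blast
qed

end

section \<open>Combining the cases by the least number of paths\<close>

context stuck_wgraph
begin

lemma not_stuck: False
proof -
  define m where "m = (LEAST m. \<exists>vs. cov m vs)"
  have ex: "\<exists>vs. cov m vs" unfolding m_def by (rule LeastI_ex[OF cov_exists])
  have least: "\<nexists>vs. cov k vs" if "k < m" for k using not_less_Least[of k "\<lambda>m. \<exists>vs. cov m vs"] that unfolding m_def by simp
  obtain vs where vs: "cov m vs" using ex by blast
  consider "m = 0" | "m = 1" | "m = 2" | k where "m = Suc k" "2 \<le> k"
    by (metis One_nat_def Suc_1 not_less_eq_eq old.nat.exhaust le_0_eq)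
  then show False
  proof cases
    case 1 then show False using no_cov0 ex by blast
  next
    case 2 then show False using cover2_isolated not_cover2 vs by blast
  next
    case 3
    then have no1: "\<not> cov 1 vs" for vs using least[of 1] by auto
    interpret cover3 V w c n by unfold_locales (rule no1)
    obtain A B C where ABC: "vs = map Some A @ None # map Some B @ None # map Some C"
      "distinct (A @ B @ C)" "set (A @ B @ C) = V" "successively S A" "successively S B" "successively S C"
      using cov2_split vs 3 by blast
    have cv: "cov (Suc 1) vs" using vs 3 by (simp add: numeral_2_eq_2)
    have "A \<noteq> []" using cov_drop_None_hd[of 1] cv ABC(1) no1 by auto
    moreover have "B \<noteq> []"
    proof
      assume "B = []"
      then have "cov 1 (map Some A @ None # map Some C)"
        using cv ABC by (auto simp: cov_def successively_append_iff successively_Cons)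
      then show False using no1 by blast
    qed
    moreover have "C \<noteq> []"
    proof
      assume "C = []"
      then have "rev vs = None # rev (map Some A @ None # map Some B)" using ABC(1) by simp
      then show False using cov_drop_None_hd[of 1] cv no1 cov_rev by metis
    qed
    ultimately show False using no_tri ABC unfolding tri_def by blast
  next
    case 4 then show False using no_large_cover least[of k] vs by auto
  qed
qed

end

section \<open>Edge-coloured multigraphs\<close>

context edge_coloured_multigraph
begin

text \<open>Parallel edges differ in colour, so the colours of a pair represent its edges, and paths
  can be coloured before edges are chosen.\<close>

definition cols :: "'v \<Rightarrow> 'v \<Rightarrow> nat set" where
  "cols u v = col ` {e \<in> E. ends e = {u, v}}"

definition mult :: "'v \<Rightarrow> 'v \<Rightarrow> nat" where
  "mult u v = card (cols u v)"

lemma finite_cols [simp]: "finite (cols u v)"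
  using finite_E by (simp add: cols_def)

lemma cols_sym: "cols u v = cols v u"
  by (simp add: cols_def insert_commute)

lemma cols_self: "cols u u = {}"
  using card_ends by (force simp: cols_def)

lemma mult_le: "mult u v \<le> c"
proof -
  have "cols u v \<subseteq> {1..c}" using col_range by (auto simp: cols_def)
  then show ?thesis using card_mono[of "{1..c}" "cols u v"] by (simp add: mult_def)
qed

lemma mult_eq_card: "mult u v = card {e \<in> E. ends e = {u, v}}"
  unfolding mult_def cols_def
  by (rule card_image) (auto simp: inj_on_def dest: parallel_col)

lemma sum_mult: "(\<Sum>u\<in>V. \<Sum>v\<in>V. mult u v) = 2 * card E"
proof -
  have "card {e \<in> E. ends e = {u, v}} = (\<Sum>e\<in>E. of_bool (ends e = {u, v}))" for u v
    using finite_E by (simp add: Int_def)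
  then have 1: "mult u v = (\<Sum>e\<in>E. of_bool (ends e = {u, v}))" for u v by (simp only: mult_eq_card)
  have "(\<Sum>u\<in>V. \<Sum>v\<in>V. mult u v) = (\<Sum>p\<in>V \<times> V. mult (fst p) (snd p))"
    by (simp add: sum.cartesian_product case_prod_unfold)
  also have "\<dots> = (\<Sum>p\<in>V \<times> V. \<Sum>e\<in>E. of_bool (ends e = {fst p, snd p}))" by (simp only: 1)
  also have "\<dots> = (\<Sum>e\<in>E. \<Sum>p\<in>V \<times> V. of_bool (ends e = {fst p, snd p}))" by (rule sum.swap)
  also have "\<dots> = (\<Sum>e\<in>E. 2)"
  proof (rule sum.cong)
    fix e assume e: "e \<in> E"
    obtain a b where ab: "ends e = {a, b}" "a \<noteq> b" using card_ends[OF e] by (auto simp: card_2_iff)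
    have "{p \<in> V \<times> V. ends e = {fst p, snd p}} = {(a, b), (b, a)}"
    proof (rule set_eqI)
      fix p :: "'v \<times> 'v"
      obtain u v where p: "p = (u, v)" by (cases p)
      have "{a, b} = {u, v} \<longleftrightarrow> u = a \<and> v = b \<or> u = b \<and> v = a" by (auto simp: doubleton_eq_iff)
      moreover have "a \<in> V" "b \<in> V" using ab(1) ends_subset[OF e] by simp_all
      ultimately show "p \<in> {p \<in> V \<times> V. ends e = {fst p, snd p}} \<longleftrightarrow> p \<in> {(a, b), (b, a)}"
        unfolding p ab(1) by auto
    qed
    then show "(\<Sum>p\<in>V \<times> V. of_bool (ends e = {fst p, snd p})) = (2::nat)"
      using finite_V ab(2) by (simp add: Int_def)
  qed simp
  finally show ?thesis by simp
qed

section \<open>Colouring walks\<close>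

fun coloured_walk :: "'v list \<Rightarrow> nat list \<Rightarrow> bool" where
  "coloured_walk [v] [] \<longleftrightarrow> True"
| "coloured_walk (u # v # vs) (k # ks) \<longleftrightarrow> k \<in> cols u v \<and> coloured_walk (v # vs) ks"
| "coloured_walk _ _ \<longleftrightarrow> False"

lemma coloured_walk_nth:
  "coloured_walk vs ks \<Longrightarrow> length vs = Suc (length ks) \<and> (\<forall>i<length ks. ks ! i \<in> cols (vs ! i) (vs ! Suc i))"
  by (induction vs ks rule: coloured_walk.induct) (auto simp: less_Suc_eq_0_disj)

lemma coloured_walk_append:
  "coloured_walk us ks \<Longrightarrow> coloured_walk vs ls \<Longrightarrow> k \<in> cols (last us) (hd vs) \<Longrightarrow>
   coloured_walk (us @ vs) (ks @ k # ls)"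
proof (induction us ks rule: coloured_walk.induct)
  case (1 v)
  then show ?case by (cases vs) auto
qed auto

lemma coloured_walk_rev: "coloured_walk vs ks \<Longrightarrow> coloured_walk (rev vs) (rev ks)"
proof (induction vs ks rule: coloured_walk.induct)
  case (2 u v vs k ks)
  then have "coloured_walk (rev (v # vs) @ [u]) (rev ks @ k # [])"
    by (intro coloured_walk_append) (auto simp: cols_sym last_rev)
  then show ?case by simp
qed auto

text \<open>\<open>a\<close> is the colour of an edge preceding the walk. It excludes one of two
  colours, and the colour chosen takes the role of \<open>a\<close> for the rest.\<close>

lemma colour_greedy:
  assumes "successively (\<lambda>u v. 2 \<le> mult u v) vs" "vs \<noteq> []"
  shows "\<exists>ks. coloured_walk vs ks \<and> distinct_adj ks \<and> (ks \<noteq> [] \<longrightarrow> hd ks \<noteq> a)"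
  using assms
proof (induction vs arbitrary: a rule: induct_list012)
  case (2 v)
  then show ?case by (intro exI[of _ "[]"]) auto
next
  case (3 u v vs)
  have "\<not> cols u v \<subseteq> {a}"
    using 3(3) card_mono[of "{a}" "cols u v"] by (auto simp: mult_def)
  then obtain k where k: "k \<in> cols u v" "k \<noteq> a" by blast
  obtain ks where "coloured_walk (v # vs) ks" "distinct_adj ks" "ks \<noteq> [] \<longrightarrow> hd ks \<noteq> k"
    using 3(2)[of k] 3(3) by auto
  then show ?case using k by (intro exI[of _ "k # ks"]) (auto simp: distinct_adj_Cons)
qed auto

lemma colour_greedy_rev:
  assumes "successively (\<lambda>u v. 2 \<le> mult u v) vs" "vs \<noteq> []"
  shows "\<exists>ks. coloured_walk vs ks \<and> distinct_adj ks \<and> (ks \<noteq> [] \<longrightarrow> last ks \<noteq> a)"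
proof -
  have "successively (\<lambda>u v. 2 \<le> mult u v) (rev vs)"
    using assms(1) by (simp add: mult_def cols_sym)
  then obtain ks where "coloured_walk (rev vs) ks" "distinct_adj ks" "ks \<noteq> [] \<longrightarrow> hd ks \<noteq> a"
    using colour_greedy[of "rev vs"] assms(2) by auto
  then show ?thesis using coloured_walk_rev[of "rev vs" ks]
    by (intro exI[of _ "rev ks"]) (auto simp: last_rev)
qed

text \<open>Greedy colourings from both ends meet at a pair with three colours, where at most two
  are excluded.\<close>

lemma colour_both_ends:
  assumes S: "successively (\<lambda>u v. 2 \<le> mult u v) vs"
    and rich: "\<not> successively (\<lambda>u v. mult u v \<le> 2) vs"
  shows "\<exists>ks. coloured_walk vs ks \<and> distinct_adj ks \<and> ks \<noteq> [] \<and> hd ks \<noteq> a \<and> last ks \<noteq> b"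
proof -
  obtain i where i: "Suc i < length vs" "2 < mult (vs ! i) (vs ! Suc i)"
    using rich by (auto simp: successively_conv_nth not_le)
  define us where "us = take (Suc i) vs"
  define ws where "ws = drop (Suc i) vs"
  have vs: "vs = us @ ws" and ne: "us \<noteq> []" "ws \<noteq> []" using i by (auto simp: us_def ws_def)
  have lh: "last us = vs ! i" "hd ws = vs ! Suc i"
    using i by (auto simp: us_def ws_def hd_drop_conv_nth take_Suc_conv_app_nth)
  have "successively (\<lambda>u v. 2 \<le> mult u v) us" "successively (\<lambda>u v. 2 \<le> mult u v) ws"
    using S unfolding vs by (auto simp: successively_append_iff)
  then obtain ks ls where
    ks: "coloured_walk us ks" "distinct_adj ks" "ks \<noteq> [] \<longrightarrow> hd ks \<noteq> a" and
    ls: "coloured_walk ws ls" "distinct_adj ls" "ls \<noteq> [] \<longrightarrow> last ls \<noteq> b"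
    using colour_greedy[of us a] colour_greedy_rev[of ws b] ne by blast
  \<comment> \<open>If a part has no edge, the middle edge is itself the first or the last one and
    must avoid \<open>a\<close> or \<open>b\<close> directly.\<close>
  define p where "p = (if ks = [] then a else last ks)"
  define q where "q = (if ls = [] then b else hd ls)"
  have "card {p, q} \<le> 2" by (simp add: card_insert_if)
  then have "\<not> cols (last us) (hd ws) \<subseteq> {p, q}"
    using i(2) lh card_mono[of "{p, q}" "cols (last us) (hd ws)"] by (auto simp: mult_def)
  then obtain k where k: "k \<in> cols (last us) (hd ws)" "k \<noteq> p" "k \<noteq> q" by blast
  have "coloured_walk vs (ks @ k # ls)" unfolding vs by (rule coloured_walk_append[OF ks(1) ls(1) k(1)])
  moreover have "distinct_adj (ks @ k # ls)"
    using ks ls k by (auto simp: distinct_adj_append_iff distinct_adj_Cons p_def q_def)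
  ultimately show ?thesis
    using ks ls k by (intro exI[of _ "ks @ k # ls"]) (auto simp: p_def q_def hd_append)
qed

lemma coloured_walk_hamiltonian:
  assumes w: "coloured_walk vs ks" and "distinct_adj ks" "distinct vs" "set vs = V"
  shows "\<exists>es. is_proper_hamiltonian_path vs es"
proof -
  note nth = coloured_walk_nth[OF w]
  have "\<forall>i\<in>{..<length ks}. \<exists>e. e \<in> E \<and> ends e = {vs ! i, vs ! Suc i} \<and> col e = ks ! i"
    using nth by (fastforce simp: cols_def)
  then obtain f where f: "\<And>i. i < length ks \<Longrightarrow> f i \<in> E \<and> ends (f i) = {vs ! i, vs ! Suc i} \<and> col (f i) = ks ! i"
    by (metis lessThan_iff)
  define es where "es = map f [0..<length ks]"
  have "is_proper_hamiltonian_path vs es"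
    unfolding is_proper_hamiltonian_path_def is_proper_path_def is_path_def
    using f nth assms by (auto simp: es_def distinct_adj_conv_nth)
  then show ?thesis by blast
qed

lemma mult_pos: "mult u v \<noteq> 0 \<Longrightarrow> \<exists>k. k \<in> cols u v"
  by (auto simp: mult_def)

lemma proper_hamiltonian_path_exists:
  assumes conn: "connected_graph" and n: "card V = n" "9 \<le> n" and c: "3 \<le> c" "2 * c + 1 \<le> n"
    and m: "c * ((n - 2) choose 2) + n \<le> card E"
  shows "\<exists>vs es. is_proper_hamiltonian_path vs es"
proof (rule ccontr)
  assume neg: "\<not> ?thesis"
  interpret G: wgraph V mult c n
    by unfold_locales (use n c finite_V mult_le cols_sym cols_self in \<open>auto simp: mult_def\<close>)
  have "stuck_wgraph V mult c n"
  proof unfold_locales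
    show "\<exists>v\<in>V. mult u v \<noteq> 0" if u: "u \<in> V" for u
    proof -
      have "V \<noteq> {u}" using n by auto
      then obtain v where v: "v \<in> V" "v \<noteq> u" using u by blast
      obtain vs es where p: "is_path vs es" "hd vs = u" "last vs = v"
        using conn u v(1) unfolding connected_graph_def by blast
      have "length es \<noteq> 0"
      proof
        assume "length es = 0"
        then have "length vs = Suc 0" using p(1) by (simp add: is_path_def)
        then show False using p(2,3) v(2) by (auto simp: length_Suc_conv)
      qed
      then have e: "es ! 0 \<in> E" "ends (es ! 0) = {vs ! 0, vs ! Suc 0}" "vs \<noteq> []" "Suc 0 < length vs" "set vs \<subseteq> V"
        using p(1) by (auto simp: is_path_def)
      then have "col (es ! 0) \<in> cols u (vs ! Suc 0)"
        using p(2) by (auto simp: cols_def hd_conv_nth)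
      moreover have "vs ! Suc 0 \<in> V" using e(4,5) nth_mem by blast
      ultimately show ?thesis by (auto simp: mult_def)
    qed
  next
    have "(\<Sum>v\<in>V. G.loss u v) = int c * (int n - 1) - int (\<Sum>v\<in>V. mult u v)" if u: "u \<in> V" for u
    proof -
      have "(\<Sum>v\<in>V. G.loss u v) = (\<Sum>v\<in>V-{u}. G.loss u v)"
        using sum.remove[OF finite_V u, of "G.loss u"] by simp
      also have "\<dots> = (\<Sum>v\<in>V-{u}. int c - int (mult u v))"
        by (intro sum.cong) (auto simp: G.loss_def)
      also have "\<dots> = int c * (int n - 1) - int (\<Sum>v\<in>V-{u}. mult u v)"
        using u finite_V n by (simp add: sum_subtractf)
      also have "(\<Sum>v\<in>V-{u}. mult u v) = (\<Sum>v\<in>V. mult u v)"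
        using sum.remove[OF finite_V u, of "mult u"] by simp
      finally show ?thesis .
    qed
    then have "(\<Sum>u\<in>V. \<Sum>v\<in>V. G.loss u v) = int n * (int c * (int n - 1)) - int (\<Sum>u\<in>V. \<Sum>v\<in>V. mult u v)"
      using n by (simp add: sum_subtractf)
    then have "(\<Sum>u\<in>V. \<Sum>v\<in>V. G.loss u v) = int n * (int c * (int n - 1)) - 2 * int (card E)"
      by (simp add: sum_mult)
    moreover have "2 * ((n - 2) choose 2) = (n - 2) * (n - 3)"
    proof -
      have "n - 2 = Suc (n - 3)" using n by simp
      moreover have "even (Suc k * k)" for k :: nat by simp
      ultimately have "even ((n - 2) * (n - 3))" by (simp only:)
      then show ?thesis using choose_two[of "n - 2"] by simp
    qed
    then have "c * ((n - 2) * (n - 3)) + 2 * n \<le> 2 * card E" using m by (metis add_mult_distrib2 mult.left_commute mult_le_mono2)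
    then have "int (c * ((n - 2) * (n - 3)) + 2 * n) \<le> int (2 * card E)" by linarith
    then have "int c * ((int n - 2) * (int n - 3)) + 2 * int n \<le> 2 * int (card E)"
      using n by (simp add: of_nat_diff)
    ultimately show "(\<Sum>u\<in>V. \<Sum>v\<in>V. G.loss u v) \<le> 2 * (int c * (2 * int n - 3) - int n)"
      by (simp add: algebra_simps)
  next
    fix us vs :: "'v list"
    assume A: "us \<noteq> []" "vs \<noteq> []" "distinct (us @ vs)" "set (us @ vs) = V"
      "successively (\<lambda>u v. 2 \<le> mult u v) us" "successively (\<lambda>u v. 2 \<le> mult u v) vs"
    show "mult (last us) (hd vs) = 0"
    proof (rule ccontr)
      assume "mult (last us) (hd vs) \<noteq> 0"
      then obtain k where k: "k \<in> cols (last us) (hd vs)" using mult_pos by blast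
      \<comment> \<open>The join gets any of its colours first; both strong paths are then coloured
        outwards from it.\<close>
      obtain ks ls where
        ks: "coloured_walk us ks" "distinct_adj ks" "ks \<noteq> [] \<longrightarrow> last ks \<noteq> k" and
        ls: "coloured_walk vs ls" "distinct_adj ls" "ls \<noteq> [] \<longrightarrow> hd ls \<noteq> k"
        using colour_greedy[of vs k] colour_greedy_rev[of us k] A by blast
      have "coloured_walk (us @ vs) (ks @ k # ls)" by (rule coloured_walk_append[OF ks(1) ls(1) k])
      moreover have "distinct_adj (ks @ k # ls)"
        using ks ls by (auto simp: distinct_adj_append_iff distinct_adj_Cons)
      ultimately show False using coloured_walk_hamiltonian A(3,4) neg by blast
    qed
  next
    fix us vs ws :: "'v list"
    assume A: "us \<noteq> []" "vs \<noteq> []" "ws \<noteq> []" "distinct (us @ vs @ ws)" "set (us @ vs @ ws) = V"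
      "successively (\<lambda>u v. 2 \<le> mult u v) us" "successively (\<lambda>u v. 2 \<le> mult u v) vs"
      "successively (\<lambda>u v. 2 \<le> mult u v) ws" "\<not> successively (\<lambda>u v. mult u v \<le> 2) vs"
      "mult (last us) (hd vs) \<noteq> 0"
    show "mult (last vs) (hd ws) = 0"
    proof (rule ccontr)
      assume "mult (last vs) (hd ws) \<noteq> 0"
      then obtain l where l: "l \<in> cols (last vs) (hd ws)" using mult_pos by blast
      obtain k where k: "k \<in> cols (last us) (hd vs)" using mult_pos A(10) by blast
      obtain ks where ks: "coloured_walk us ks" "distinct_adj ks" "ks \<noteq> [] \<longrightarrow> last ks \<noteq> k"
        using colour_greedy_rev[OF A(6,1)] by blast
      obtain ls where ls: "coloured_walk vs ls" "distinct_adj ls" "ls \<noteq> []" "hd ls \<noteq> k" "last ls \<noteq> l"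
        using colour_both_ends[OF A(7,9)] by blast
      obtain js where js: "coloured_walk ws js" "distinct_adj js" "js \<noteq> [] \<longrightarrow> hd js \<noteq> l"
        using colour_greedy[OF A(8,3)] by blast
      have "coloured_walk (vs @ ws) (ls @ l # js)" by (rule coloured_walk_append[OF ls(1) js(1) l])
      then have "coloured_walk (us @ vs @ ws) (ks @ k # ls @ l # js)"
        using k A(2) by (intro coloured_walk_append[OF ks(1)]) simp_all
      moreover have "distinct_adj (ks @ k # ls @ l # js)"
        using ks ls js by (auto simp: distinct_adj_append_iff distinct_adj_Cons)
      ultimately show False using coloured_walk_hamiltonian A(4,5) neg by blast
    qed
  qed
  then show False by (rule stuck_wgraph.not_stuck)
qed

end

theorem theorem4p6:
  fixes V :: "'v set" and E :: "'e set" and ends :: "'e \<Rightarrow> 'v set"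
    and col :: "'e \<Rightarrow> nat" and c n m :: nat
  assumes "edge_coloured_multigraph V E ends col c"
    and "multigraph.connected_graph V E ends"
    and "card V = n"
    and "card E = m"
    and "n \<ge> 9"
    and "3 \<le> c"
    and "real c < real n / 2"
    and "m \<ge> c * ((n - 2) choose 2) + n"
  shows "\<exists>vs es. edge_coloured_multigraph.is_proper_hamiltonian_path V E ends col vs es"
proof -
  interpret edge_coloured_multigraph V E ends col c by fact
  have "2 * c + 1 \<le> n" using assms(7) by linarith
  then show ?thesis using proper_hamiltonian_path_exists[of n] assms by blast
qed

end
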